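(* Set $C:=\begin{bmatrix}0&1\\1&1\end{bmatrix}\in\mathrm{M}_2(\mathbb{F}_2)$. Up to equivalence, exactly five $3$-dimensional affine subspaces of $\mathrm{M}_3(\mathbb{F}_2)$ are included in $\mathrm{GL}_3(\mathbb{F}_2)$: they are the ones which contain $I_3$ and with respective translation vector spaces $$\mathrm{NT}_3(\mathbb{F}_2),\quad \mathbb{F}_2C\vee\{0\},\quad \{0\}\vee\mathbb{F}_2C,\quad \mathcal{T}_1\quad\text{and}\quad\mathcal{T}_2.$$
   Context: Two affine subspaces $\mathcal{A}_1,\mathcal{A}_2$ of $\mathrm{M}_3(\mathbb{F}_2)$ are equivalent when $\mathcal{A}_2=P\mathcal{A}_1Q$ for some $P,Q\in\mathrm{GL}_3(\mathbb{F}_2)$. The affine subspace containing $I_3$ with translation vector space $H$ is $I_3+H$. $\mathrm{NT}_3(\mathbb{F}_2)$ is the space of all strictly upper-triangular $3\times3$ matrices over $\mathbb{F}_2$. For linear subspaces $\mathcal{A}$ of $\mathrm{M}_n(\mathbb{K})$ and $\mathcal{B}$ of $\mathrm{M}_p(\mathbb{K})$, $\mathcal{A}\vee\mathcal{B}$ is the space of all matrices $\begin{bmatrix}A&D\\ [0]_{p\times n}&B\end{bmatrix}$ with $A\in\mathcal{A}$, $B\in\mathcal{B}$ and $D\in\mathrm{M}_{n,p}(\mathbb{K})$. In the claim, $\mathbb{F}_2C$ is the linear span of $C$ in $\mathrm{M}_2(\mathbb{F}_2)$ and $\{0\}$ is the zero subspace of $\mathrm{M}_1(\mathbb{F}_2)$.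 Moreover $$\mathcal{T}_1:=\left\{\begin{bmatrix}a&b&a\\ a&a&c\\ b+c&a&a\end{bmatrix}\mid(a,b,c)\in(\mathbb{F}_2)^3\right\},\qquad \mathcal{T}_2:=\left\{\begin{bmatrix}a&b&a\\ a&a&c\\ 0&a&a\end{bmatrix}\mid(a,b,c)\in(\mathbb{F}_2)^3\right\}.$$ *)

theory Defs
  imports "HOL-Library.Z2" "Jordan_Normal_Form.VS_Connect"
begin

text \<open>
  The field with two elements is the type \<open>bit\<close>. The linear structure of the space of
  \<open>n \<times> n\<close> matrices is the one of \<open>module_mat\<close>, over the ground field \<open>class_ring\<close>.
\<close>

definition GL :: "nat \<Rightarrow> 'a::field mat set" where
  "GL n = {P \<in> carrier_mat n n. invertible_mat P}"

definition lin_subspace :: "nat \<Rightarrow> 'a::field mat set \<Rightarrow> bool" where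
  "lin_subspace n W \<longleftrightarrow> VectorSpace.subspace class_ring W (module_mat TYPE('a) n n)"

definition lin_dim :: "nat \<Rightarrow> 'a::field mat set \<Rightarrow> nat" where
  "lin_dim n W = vectorspace.dim class_ring ((module_mat TYPE('a) n n)\<lparr>carrier := W\<rparr>)"

definition lin_span :: "nat \<Rightarrow> 'a::field mat set \<Rightarrow> 'a mat set" where
  "lin_span n S = LinearCombinations.module.span class_ring (module_mat TYPE('a) n n) S"

definition translate :: "'a::field mat \<Rightarrow> 'a mat set \<Rightarrow> 'a mat set" where
  "translate A W = (\<lambda>X. A + X) ` W"

definition affine_subspace :: "nat \<Rightarrow> nat \<Rightarrow> 'a::field mat set \<Rightarrow> bool" where
  "affine_subspace n d \<A> \<longleftrightarrow>
     (\<exists>A \<in> carrier_mat n n. \<exists>W. lin_subspace n W \<and> lin_dim n W = d \<and> \<A> = translate A W)"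

definition equivalent_sets :: "nat \<Rightarrow> 'a::field mat set \<Rightarrow> 'a mat set \<Rightarrow> bool" where
  "equivalent_sets n \<A>\<^sub>1 \<A>\<^sub>2 \<longleftrightarrow>
     (\<exists>P \<in> GL n. \<exists>Q \<in> GL n. \<A>\<^sub>2 = (\<lambda>A. P * A * Q) ` \<A>\<^sub>1)"

definition NT :: "nat \<Rightarrow> 'a::field mat set" where
  "NT n = {A \<in> carrier_mat n n. \<forall>i<n. \<forall>j<n. j \<le> i \<longrightarrow> A $$ (i, j) = 0}"

text \<open>\<open>join n p \<A> \<B>\<close> is $\mathcal{A} \vee \mathcal{B}$, for sets \<open>\<A>\<close> of \<open>n \<times> n\<close> and
  \<open>\<B>\<close> of \<open>p \<times> p\<close> matrices.\<close>

definition join :: "nat \<Rightarrow> nat \<Rightarrow> 'a::field mat set \<Rightarrow> 'a mat set \<Rightarrow> 'a mat set" where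
  "join n p \<A> \<B> = {four_block_mat A D (0\<^sub>m p n) B | A B D.
     A \<in> \<A> \<and> B \<in> \<B> \<and> D \<in> carrier_mat n p}"

definition C :: "bit mat" where
  "C = mat_of_rows_list 2 [[0, 1], [1, 1]]"

definition T1 :: "bit mat set" where
  "T1 = {mat_of_rows_list 3 [[a, b, a], [a, a, c], [b + c, a, a]] | a b c. True}"

definition T2 :: "bit mat set" where
  "T2 = {mat_of_rows_list 3 [[a, b, a], [a, a, c], [0, a, a]] | a b c. True}"

definition translation_spaces :: "bit mat set list" where
  "translation_spaces =
     [NT 3, join 2 1 (lin_span 2 {C}) {0\<^sub>m 1 1}, join 1 2 {0\<^sub>m 1 1} (lin_span 2 {C}), T1, T2]"

end

theory Submission
  imports Defs
begin

text \<open>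
  Multiplying by the inverse of one of its elements moves an affine subspace of invertible
  matrices to one of the form \<open>I + H\<close> with \<open>H\<close> linear, and conjugating \<open>H\<close> gives an equivalent
  affine subspace. So the linear spaces \<open>H\<close> with three dimensions, that is with eight elements
  (\<open>card_bit_subspace\<close>), have to be classified under the condition that \<open>I + X\<close> is invertible
  for every \<open>X\<close> in \<open>H\<close>.

  The five spaces are not equivalent because equivalent affine subspaces have equivalent
  translation spaces (\<open>equivalent_translates\<close>), and three properties that depend only on the
  equivalence class of a linear space separate them (\<open>signature\<close>): whether a nonzero matrix
  annihilates the whole space from the right, whether one does so from the left, and whether
  the space contains an invertible matrix.

  The list is complete for the following reason. Take a nonzero \<open>M\<close> in \<open>H\<close>. As \<open>I + M\<close> is
  invertible, \<open>1\<close> is not an eigenvalue of \<open>M\<close>. If \<open>M\<close> has a cyclic vector, it is conjugate to the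
  companion matrix of a cubic polynomial that does not vanish at \<open>1\<close>, and there are four of
  those. Otherwise the minimal polynomial of \<open>M\<close> has degree at most two and no root \<open>1\<close>; as an
  irreducible quadratic polynomial is impossible in the odd dimension three, \<open>M\<^sup>2 = 0\<close>, the matrix
  \<open>M\<close> has rank one, and it is conjugate to the matrix unit with entry one in row one and column
  two. Hence \<open>M\<close> may be assumed to be one of five explicit matrices
  (\<open>conjugate_to_normal_form\<close>). All five have entry one in row one and column two, so \<open>H\<close> is the
  direct sum of the line through \<open>M\<close> and of the plane of those elements of \<open>H\<close> that have entry
  zero there. Few planes are possible: every element \<open>X\<close> of one must make \<open>I + X\<close> and
  \<open>I + M + X\<close> invertible, which leaves at most 35 nonzero matrices \<open>X\<close>. For each pair of
  candidates that span an admissible plane, a conjugation is found that carries \<open>H\<close> to one of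
  six model spaces (\<open>pair_recognised\<close>, \<open>recognise\<close>).

  There are six models and not five because conjugation is finer than equivalence: replacing
  the identity by another element of the affine subspace as base point also changes \<open>H\<close>. Only
  the class of \<open>T2\<close> splits under conjugation, into two classes; the second one is represented
  by a left translate of \<open>T2\<close> (\<open>shifted_T2_equivalent\<close>).

  The finite computations run on matrices with Boolean entries, by rewriting inside the logic.
\<close>

section \<open>Linear subspaces of matrices over a finite field\<close>

lemma lin_subspace_iff:
  fixes W :: "'a::field mat set"
  shows "lin_subspace n W \<longleftrightarrow> W \<subseteq> carrier_mat n n \<and> 0\<^sub>m n n \<in> W \<and>
    (\<forall>X \<in> W. \<forall>Y \<in> W. X + Y \<in> W) \<and> (\<forall>c. \<forall>X \<in> W. c \<cdot>\<^sub>m X \<in> W)"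
proof -
  interpret vectorspace class_ring "module_mat TYPE('a) n n" by (rule matrix_vs)
  have "module class_ring (module_mat TYPE('a) n n)" by unfold_locales
  then show ?thesis
    unfolding lin_subspace_def VectorSpace.subspace_def submodule_def
    using vectorspace_axioms by (auto simp: matrix_vs_simps)
qed

lemma lin_subspace_bit_iff:
  fixes W :: "bit mat set"
  shows "lin_subspace n W \<longleftrightarrow> W \<subseteq> carrier_mat n n \<and> 0\<^sub>m n n \<in> W \<and>
    (\<forall>X \<in> W. \<forall>Y \<in> W. X + Y \<in> W)"
proof -
  have "c \<cdot>\<^sub>m X \<in> W" if "W \<subseteq> carrier_mat n n" "0\<^sub>m n n \<in> W" "X \<in> W" for c :: bit and X
  proof (cases c)
    case zero
    have "0 \<cdot>\<^sub>m X = 0\<^sub>m n n" using that by (intro eq_matI) auto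
    then show ?thesis using that zero by simp
  next
    case one
    have "1 \<cdot>\<^sub>m X = X" by (intro eq_matI) auto
    then show ?thesis using that one by simp
  qed
  then show ?thesis by (auto simp: lin_subspace_iff)
qed

lemma finite_carrier_mat:
  assumes "finite (UNIV :: 'a set)"
  shows "finite (carrier_mat m n :: 'a mat set)"
proof -
  let ?F = "({0..<m} \<times> {0..<n}) \<rightarrow>\<^sub>E (UNIV :: 'a set)"
  have "carrier_mat m n \<subseteq> mat m n ` ?F"
  proof
    fix A :: "'a mat" assume A: "A \<in> carrier_mat m n"
    let ?f = "restrict (\<lambda>ij. A $$ ij) ({0..<m} \<times> {0..<n})"
    have "A = mat m n ?f" using A by (intro eq_matI) auto
    moreover have "?f \<in> ?F" by auto
    ultimately show "A \<in> mat m n ` ?F" by blast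
  qed
  moreover have "finite ?F" using assms by (intro finite_PiE) auto
  ultimately show ?thesis using finite_surj by blast
qed

text \<open>
  Coordinates with respect to a basis identify the subspace with the functions from the basis
  to the field. Over a finite field the dimension can thus be read off from the cardinality,
  so that dimensions need no further linear algebra below.
\<close>

lemma card_lin_subspace:
  fixes W :: "'a::field mat set"
  assumes fin: "finite (UNIV :: 'a set)" and W: "lin_subspace n W"
  shows "card W = card (UNIV :: 'a set) ^ lin_dim n W"
proof -
  interpret V: vectorspace class_ring "module_mat TYPE('a) n n" by (rule matrix_vs)
  interpret W: vectorspace class_ring "V.vs W"
    using W by (intro V.subspace_is_vs) (simp add: lin_subspace_def)
  have "finite W"
    using W fin by (meson finite_carrier_mat finite_subset lin_subspace_iff)
  then have "W.fin_dim"
    unfolding W.fin_dim_def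
    using W.in_own_span[of W] W.span_closed[of W] by (intro exI[of _ W]) auto
  then obtain B where B: "finite B" "W.basis B" using W.finite_basis_exists by blast
  then have BW: "B \<subseteq> W" by (simp add: W.basis_def)
  \<comment> \<open>unique coordinates, with coefficient functions that are undefined off the basis\<close>
  have "\<forall>v \<in> W. \<exists>!a. a \<in> B \<rightarrow>\<^sub>E UNIV \<and> W.lincomb a B = v"
    using B BW W.basis_criterion[of B] by (simp add: class_ring_simps)
  moreover have "W.lincomb a B \<in> W" for a
    using W.lincomb_closed[of B a] BW by (simp add: class_ring_simps)
  ultimately have "bij_betw (\<lambda>a. W.lincomb a B) (B \<rightarrow>\<^sub>E UNIV) W"
    unfolding bij_betw_def inj_on_def by (auto simp: image_iff)
  then have "card W = card (B \<rightarrow>\<^sub>E (UNIV :: 'a set))" by (simp add: bij_betw_same_card)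
  also have "\<dots> = card (UNIV :: 'a set) ^ card B" using B by (simp add: card_PiE)
  also have "card B = lin_dim n W" using B W.dim_basis by (simp add: lin_dim_def)
  finally show ?thesis .
qed

lemma card_bit_subspace:
  fixes W :: "bit mat set"
  assumes "lin_subspace n W"
  shows "card W = 2 ^ lin_dim n W"
proof -
  have U: "(UNIV :: bit set) = {0, 1}" by (auto intro: bit.exhaust)
  have "finite (UNIV :: bit set)" and "card (UNIV :: bit set) = 2" by (simp_all add: U)
  then show ?thesis using card_lin_subspace assms by metis
qed

section \<open>Equivalence of sets of square matrices\<close>

lemma GL_E:
  fixes P :: "'a::field mat"
  assumes "P \<in> GL n"
  obtains Q where "Q \<in> GL n" "P * Q = 1\<^sub>m n" "Q * P = 1\<^sub>m n" "P \<in> carrier_mat n n" "Q \<in> carrier_mat n n"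
proof -
  have P: "P \<in> carrier_mat n n" using assms by (simp add: GL_def)
  obtain Q where Q: "P * Q = 1\<^sub>m n" "Q * P = 1\<^sub>m (dim_row Q)"
    using assms P unfolding GL_def invertible_mat_def inverts_mat_def by auto
  have "dim_row (Q * P) = dim_row Q" "dim_col (P * Q) = dim_col Q" "dim_col (Q * P) = n" using P by auto
  then have Qc: "Q \<in> carrier_mat n n" using Q by auto
  then have "Q \<in> GL n"
    using P Q unfolding GL_def invertible_mat_def inverts_mat_def by auto
  then show ?thesis using that P Q Qc by auto
qed

lemma GL_I:
  fixes P :: "'a::field mat"
  assumes "P \<in> carrier_mat n n" "Q \<in> carrier_mat n n" "P * Q = 1\<^sub>m n" "Q * P = 1\<^sub>m n"
  shows "P \<in> GL n"
  using assms unfolding GL_def invertible_mat_def inverts_mat_def by auto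

lemma GL_carrier: "P \<in> GL n \<Longrightarrow> P \<in> carrier_mat n n"
  by (simp add: GL_def)

lemma GL_one: "1\<^sub>m n \<in> GL n"
  by (rule GL_I[of _ _ "1\<^sub>m n"]) auto

lemma GL_mult:
  fixes P :: "'a::field mat"
  assumes "P \<in> GL n" "Q \<in> GL n"
  shows "P * Q \<in> GL n"
proof -
  obtain P' where P: "P * P' = 1\<^sub>m n" "P' * P = 1\<^sub>m n" "P \<in> carrier_mat n n" "P' \<in> carrier_mat n n"
    using GL_E[OF assms(1)] by metis
  obtain Q' where Q: "Q * Q' = 1\<^sub>m n" "Q' * Q = 1\<^sub>m n" "Q \<in> carrier_mat n n" "Q' \<in> carrier_mat n n"
    using GL_E[OF assms(2)] by metis
  show ?thesis
  proof (rule GL_I)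
    have "P * Q * (Q' * P') = P * (Q * Q') * P'" using P(3,4) Q(3,4) by (simp add: assoc_mult_mat[of _ n n _ n _ n])
    then show "P * Q * (Q' * P') = 1\<^sub>m n" using P Q by simp
    have "Q' * P' * (P * Q) = Q' * (P' * P) * Q" using P(3,4) Q(3,4) by (simp add: assoc_mult_mat[of _ n n _ n _ n])
    then show "Q' * P' * (P * Q) = 1\<^sub>m n" using P Q by simp
  qed (use P Q in auto)
qed

lemma sandwich_cancel:
  fixes P :: "'a::field mat"
  assumes "P \<in> carrier_mat n n" "Q \<in> carrier_mat n n" "P' \<in> carrier_mat n n" "Q' \<in> carrier_mat n n"
    and "P' * P = 1\<^sub>m n" "Q * Q' = 1\<^sub>m n" and "A \<in> carrier_mat n n"
  shows "P' * (P * A * Q) * Q' = A"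
proof -
  have "P' * (P * A * Q) * Q' = (P' * P) * A * (Q * Q')"
    using assms(1-4,7) by (simp add: assoc_mult_mat[of _ n n _ n _ n])
  then show ?thesis using assms by simp
qed

lemma equivalent_sets_sym:
  fixes A :: "'a::field mat set"
  assumes "equivalent_sets n A B" and A: "A \<subseteq> carrier_mat n n"
  shows "equivalent_sets n B A"
proof -
  obtain P Q where PQ: "P \<in> GL n" "Q \<in> GL n" and B: "B = (\<lambda>X. P * X * Q) ` A"
    using assms by (auto simp: equivalent_sets_def)
  obtain P' where P: "P' \<in> GL n" "P' * P = 1\<^sub>m n" "P \<in> carrier_mat n n" "P' \<in> carrier_mat n n"
    using GL_E[OF PQ(1)] by metis
  obtain Q' where Q: "Q' \<in> GL n" "Q * Q' = 1\<^sub>m n" "Q \<in> carrier_mat n n" "Q' \<in> carrier_mat n n"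
    using GL_E[OF PQ(2)] by metis
  have "P' * (P * X * Q) * Q' = X" if "X \<in> A" for X
    using sandwich_cancel P Q A that by blast
  then have "A = (\<lambda>X. P' * X * Q') ` B" unfolding B image_image by force
  then show ?thesis using P Q unfolding equivalent_sets_def by blast
qed

lemma equivalent_sets_trans:
  fixes A :: "'a::field mat set"
  assumes "equivalent_sets n A B" "equivalent_sets n B D" and A: "A \<subseteq> carrier_mat n n"
  shows "equivalent_sets n A D"
proof -
  obtain P Q where PQ: "P \<in> GL n" "Q \<in> GL n" and B: "B = (\<lambda>X. P * X * Q) ` A"
    using assms by (auto simp: equivalent_sets_def)
  obtain R S where RS: "R \<in> GL n" "S \<in> GL n" and D: "D = (\<lambda>X. R * X * S) ` B"
    using assms by (auto simp: equivalent_sets_def)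
  have "R * (P * X * Q) * S = (R * P) * X * (Q * S)" if "X \<in> A" for X
    using that A PQ[THEN GL_carrier] RS[THEN GL_carrier]
    by (simp add: assoc_mult_mat[of _ n n _ n _ n] mult_carrier_mat[of _ n n _ n] subset_eq)
  then have "D = (\<lambda>X. (R * P) * X * (Q * S)) ` A"
    unfolding D B image_image by auto
  then show ?thesis using PQ RS GL_mult unfolding equivalent_sets_def by metis
qed

lemma sandwich_add:
  fixes P :: "'a::field mat"
  assumes "P \<in> carrier_mat n n" "Q \<in> carrier_mat n n" "A \<in> carrier_mat n n" "X \<in> carrier_mat n n"
  shows "P * (A + X) * Q = P * A * Q + P * X * Q"
  using assms by (simp add: mult_add_distrib_mat[of _ n n _ n] add_mult_distrib_mat[of _ n n _ _ n])

lemma sandwich_translate: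
  fixes P :: "'a::field mat"
  assumes "P \<in> carrier_mat n n" "Q \<in> carrier_mat n n" "A \<in> carrier_mat n n" "W \<subseteq> carrier_mat n n"
  shows "(\<lambda>X. P * X * Q) ` translate A W = translate (P * A * Q) ((\<lambda>X. P * X * Q) ` W)"
proof -
  have "P * (A + X) * Q = P * A * Q + P * X * Q" if "X \<in> W" for X
    using assms that sandwich_add by blast
  then show ?thesis unfolding translate_def image_image by auto
qed

lemma sandwich_subspace:
  fixes W :: "'a::field mat set"
  assumes PQ: "P \<in> GL n" "Q \<in> GL n" and W: "lin_subspace n W"
  shows "lin_subspace n ((\<lambda>X. P * X * Q) ` W)" and "card ((\<lambda>X. P * X * Q) ` W) = card W"
proof -
  obtain P' where P: "P' * P = 1\<^sub>m n" "P \<in> carrier_mat n n" "P' \<in> carrier_mat n n"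
    using GL_E[OF PQ(1)] by metis
  obtain Q' where Q: "Q * Q' = 1\<^sub>m n" "Q \<in> carrier_mat n n" "Q' \<in> carrier_mat n n"
    using GL_E[OF PQ(2)] by metis
  have Wc: "W \<subseteq> carrier_mat n n" using W by (simp add: lin_subspace_iff)
  have 0: "P * 0\<^sub>m n n * Q = 0\<^sub>m n n" using P Q by simp
  have s: "P * (c \<cdot>\<^sub>m X) * Q = c \<cdot>\<^sub>m (P * X * Q)" if "X \<in> W" for c X
    using P(2) Q(2) Wc that
    by (simp add: mult_smult_distrib[of _ n n _ n] mult_smult_assoc_mat[of _ n n _ n] subset_eq)
  have a: "P * X * Q + P * Y * Q = P * (X + Y) * Q" if "X \<in> W" "Y \<in> W" for X Y
    using P Q Wc that by (intro sandwich_add[symmetric]) auto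
  show "lin_subspace n ((\<lambda>X. P * X * Q) ` W)"
    unfolding lin_subspace_iff
  proof (intro conjI ballI allI)
    show "(\<lambda>X. P * X * Q) ` W \<subseteq> carrier_mat n n" using P Q Wc by auto
    show "0\<^sub>m n n \<in> (\<lambda>X. P * X * Q) ` W"
      using W 0 by (metis image_eqI lin_subspace_iff)
  next
    fix X Y assume "X \<in> (\<lambda>X. P * X * Q) ` W" "Y \<in> (\<lambda>X. P * X * Q) ` W"
    then show "X + Y \<in> (\<lambda>X. P * X * Q) ` W"
      using a W by (auto simp: lin_subspace_iff)
  next
    fix c X assume "X \<in> (\<lambda>X. P * X * Q) ` W"
    then show "c \<cdot>\<^sub>m X \<in> (\<lambda>X. P * X * Q) ` W"
      using s[symmetric] W by (auto simp: lin_subspace_iff)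
  qed
  have "inj_on (\<lambda>X. P * X * Q) W"
  proof (rule inj_on_inverseI)
    fix X assume "X \<in> W"
    then show "P' * (P * X * Q) * Q' = X" using sandwich_cancel P Q Wc by blast
  qed
  then show "card ((\<lambda>X. P * X * Q) ` W) = card W" by (rule card_image)
qed

lemma translate_carrier: "A \<in> carrier_mat n n \<Longrightarrow> W \<subseteq> carrier_mat n n \<Longrightarrow> translate A W \<subseteq> carrier_mat n n"
  by (auto simp: translate_def)

text \<open>
  The translation space is determined by the affine subspace alone, as its set of differences.
\<close>

lemma translate_differences:
  fixes W :: "'a::field mat set"
  assumes A: "A \<in> carrier_mat n n" and W: "lin_subspace n W"
  shows "{X - Y | X Y. X \<in> translate A W \<and> Y \<in> translate A W} = W"
proof -
  have Wc: "W \<subseteq> carrier_mat n n" and W0: "0\<^sub>m n n \<in> W"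
    and Wa: "\<And>X Y. X \<in> W \<Longrightarrow> Y \<in> W \<Longrightarrow> X + Y \<in> W"
    and Ws: "\<And>c X. X \<in> W \<Longrightarrow> c \<cdot>\<^sub>m X \<in> W"
    using W by (auto simp: lin_subspace_iff)
  have d: "(A + X) - (A + Y) = X + (- 1) \<cdot>\<^sub>m Y" if "X \<in> W" "Y \<in> W" for X Y
  proof -
    have "X \<in> carrier_mat n n" "Y \<in> carrier_mat n n" using Wc that by auto
    then show ?thesis using A by (intro eq_matI) auto
  qed
  have z: "(A + X) - (A + 0\<^sub>m n n) = X" if "X \<in> W" for X
  proof -
    have "X \<in> carrier_mat n n" using Wc that by auto
    then show ?thesis using A by (intro eq_matI) auto
  qed
  show ?thesis
  proof (intro equalityI subsetI)
    fix Z assume "Z \<in> {X - Y | X Y. X \<in> translate A W \<and> Y \<in> translate A W}"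
    then show "Z \<in> W" using d Wa Ws by (auto simp: translate_def)
  next
    fix Z assume "Z \<in> W"
    then have "Z = (A + Z) - (A + 0\<^sub>m n n)" "A + Z \<in> translate A W" "A + 0\<^sub>m n n \<in> translate A W"
      using z W0 by (auto simp: translate_def)
    then show "Z \<in> {X - Y | X Y. X \<in> translate A W \<and> Y \<in> translate A W}" by blast
  qed
qed

text \<open>
  An equivalence maps differences to differences, so it restricts to the translation spaces.
  Invariants of linear spaces therefore separate affine subspaces.
\<close>

lemma equivalent_translates:
  fixes W :: "'a::field mat set"
  assumes A: "A \<in> carrier_mat n n" and W: "lin_subspace n W"
    and B: "B \<in> carrier_mat n n" and U: "lin_subspace n U"
    and eq: "equivalent_sets n (translate A W) (translate B U)"
  shows "equivalent_sets n W U"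
proof -
  obtain P Q where PQ: "P \<in> GL n" "Q \<in> GL n"
    and BU: "translate B U = (\<lambda>X. P * X * Q) ` translate A W"
    using eq by (auto simp: equivalent_sets_def)
  have "P \<in> carrier_mat n n" "Q \<in> carrier_mat n n" "W \<subseteq> carrier_mat n n"
    using PQ W by (auto simp: GL_def lin_subspace_iff)
  then have "translate B U = translate (P * A * Q) ((\<lambda>X. P * X * Q) ` W)"
    and C: "P * A * Q \<in> carrier_mat n n"
    using BU sandwich_translate[of P n Q A W] A by auto
  then have "U = (\<lambda>X. P * X * Q) ` W"
    using translate_differences[OF B U] translate_differences[OF C sandwich_subspace(1)[OF PQ W]]
    by simp
  then show ?thesis using PQ unfolding equivalent_sets_def by blast
qed

text \<open>
  Multiplying from the left by the inverse of the base point moves the base point to the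
  identity matrix.
\<close>

lemma equivalent_to_translate_of_one:
  fixes A :: "'a::field mat"
  assumes W: "lin_subspace n W" and GL: "translate A W \<subseteq> GL n" and A: "A \<in> carrier_mat n n"
  obtains W' where "lin_subspace n W'" "card W' = card W" "translate (1\<^sub>m n) W' \<subseteq> GL n"
    "equivalent_sets n (translate (1\<^sub>m n) W') (translate A W)"
proof -
  have Wc: "W \<subseteq> carrier_mat n n" and "0\<^sub>m n n \<in> W" using W by (auto simp: lin_subspace_iff)
  then have "A + 0\<^sub>m n n \<in> translate A W" unfolding translate_def by blast
  then have AG: "A \<in> GL n" using GL A by auto
  obtain B where B: "B \<in> GL n" "B * A = 1\<^sub>m n" "B \<in> carrier_mat n n"
    using GL_E[OF AG] by metis
  let ?W' = "(\<lambda>X. B * X * 1\<^sub>m n) ` W"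
  have img: "(\<lambda>X. B * X * 1\<^sub>m n) ` translate A W = translate (1\<^sub>m n) ?W'"
    using sandwich_translate[of B n "1\<^sub>m n" A W] B A Wc by simp
  then have eq: "equivalent_sets n (translate A W) (translate (1\<^sub>m n) ?W')"
    using B GL_one unfolding equivalent_sets_def by metis
  have "translate (1\<^sub>m n) ?W' \<subseteq> GL n"
    unfolding img[symmetric] using GL B(1) GL_one GL_mult by blast
  then show ?thesis
    using that[of ?W'] sandwich_subspace[OF B(1) GL_one W] equivalent_sets_sym[OF eq]
      translate_carrier[OF A Wc] by blast
qed

section \<open>Boolean matrices of order three\<close>

text \<open>
  A matrix of order three over the field with two elements is stored as its three rows, with
  exclusive disjunction as addition. The functions below match on explicit tuples: the rewriting
  engine unfolds them only once their arguments are known, which keeps the later computations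
  small.
\<close>

type_synonym bvec = "bool \<times> bool \<times> bool"
type_synonym bmat = "bvec \<times> bvec \<times> bvec"

fun bvec_add :: "bvec \<Rightarrow> bvec \<Rightarrow> bvec" where
  "bvec_add (a, b, c) (d, e, f) = (a \<noteq> d, b \<noteq> e, c \<noteq> f)"

fun badd :: "bmat \<Rightarrow> bmat \<Rightarrow> bmat" where
  "badd (r, s, t) (u, v, w) = (bvec_add r u, bvec_add s v, bvec_add t w)"

fun row_times :: "bvec \<Rightarrow> bmat \<Rightarrow> bvec" where
  "row_times (a, b, c) (r, s, t) =
     bvec_add (if a then r else (False, False, False))
       (bvec_add (if b then s else (False, False, False))
         (if c then t else (False, False, False)))"

fun bmult :: "bmat \<Rightarrow> bmat \<Rightarrow> bmat" where
  "bmult (r, s, t) B = (row_times r B, row_times s B, row_times t B)"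

fun bdet :: "bmat \<Rightarrow> bool" where
  "bdet ((a, b, c), (d, e, f), (g, h, i)) =
     ((a \<and> ((e \<and> i) \<noteq> (f \<and> h))) \<noteq>
      ((b \<and> ((d \<and> i) \<noteq> (f \<and> g))) \<noteq> (c \<and> ((d \<and> h) \<noteq> (e \<and> g)))))"

fun badj :: "bmat \<Rightarrow> bmat" where
  "badj ((a, b, c), (d, e, f), (g, h, i)) =
     (((e \<and> i) \<noteq> (f \<and> h), (b \<and> i) \<noteq> (c \<and> h), (b \<and> f) \<noteq> (c \<and> e)),
      ((d \<and> i) \<noteq> (f \<and> g), (a \<and> i) \<noteq> (c \<and> g), (a \<and> f) \<noteq> (c \<and> d)),
      ((d \<and> h) \<noteq> (e \<and> g), (a \<and> h) \<noteq> (b \<and> g), (a \<and> e) \<noteq> (b \<and> d)))"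

definition bzero :: bmat where
  "bzero = ((False, False, False), (False, False, False), (False, False, False))"

definition bone :: bmat where
  "bone = ((True, False, False), (False, True, False), (False, False, True))"

definition bvecs :: "bvec list" where
  "bvecs = List.product [False, True] (List.product [False, True] [False, True])"

definition bmats :: "bmat list" where
  "bmats = List.product bvecs (List.product bvecs bvecs)"

text \<open>
  Conjugation by \<open>P\<close> when \<open>bdet P\<close> holds: the adjugate is then the inverse.
\<close>

fun bconj :: "bmat \<Rightarrow> bmat \<Rightarrow> bmat" where
  "bconj P M = bmult (bmult P M) (badj P)"

definition one_plus_invertible :: "bmat \<Rightarrow> bool" where
  "one_plus_invertible M = bdet (badd bone M)"

section \<open>Boolean matrices as matrices over the field with two elements\<close>

fun mat_of :: "bmat \<Rightarrow> bit mat" where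
  "mat_of ((a, b, c), (d, e, f), (g, h, i)) = mat_of_rows_list 3
     [[of_bool a, of_bool b, of_bool c], [of_bool d, of_bool e, of_bool f],
      [of_bool g, of_bool h, of_bool i]]"

declare mat_of.simps [simp del]

lemma less_3_iff: "i < (3::nat) \<longleftrightarrow> i = 0 \<or> i = 1 \<or> i = 2"
  by auto

lemma mat_of_carrier [simp]: "mat_of M \<in> carrier_mat 3 3"
  by (cases M rule: mat_of.cases) (simp add: mat_of.simps mat_of_rows_list_def numeral_3_eq_3)

lemma mat_of_index:
  "mat_of ((a, b, c), (d, e, f), (g, h, i)) $$ (0, 0) = of_bool a"
  "mat_of ((a, b, c), (d, e, f), (g, h, i)) $$ (0, Suc 0) = of_bool b"
  "mat_of ((a, b, c), (d, e, f), (g, h, i)) $$ (0, 2) = of_bool c"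
  "mat_of ((a, b, c), (d, e, f), (g, h, i)) $$ (Suc 0, 0) = of_bool d"
  "mat_of ((a, b, c), (d, e, f), (g, h, i)) $$ (Suc 0, Suc 0) = of_bool e"
  "mat_of ((a, b, c), (d, e, f), (g, h, i)) $$ (Suc 0, 2) = of_bool f"
  "mat_of ((a, b, c), (d, e, f), (g, h, i)) $$ (2, 0) = of_bool g"
  "mat_of ((a, b, c), (d, e, f), (g, h, i)) $$ (2, Suc 0) = of_bool h"
  "mat_of ((a, b, c), (d, e, f), (g, h, i)) $$ (2, 2) = of_bool i"
  by (simp_all add: mat_of.simps mat_of_rows_list_def)

lemma eq_mat3I:
  assumes "A \<in> carrier_mat 3 3" "B \<in> carrier_mat 3 3"
    and "A $$ (0, 0) = B $$ (0, 0)" "A $$ (0, Suc 0) = B $$ (0, Suc 0)" "A $$ (0, 2) = B $$ (0, 2)"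
    and "A $$ (Suc 0, 0) = B $$ (Suc 0, 0)" "A $$ (Suc 0, Suc 0) = B $$ (Suc 0, Suc 0)"
      "A $$ (Suc 0, 2) = B $$ (Suc 0, 2)"
    and "A $$ (2, 0) = B $$ (2, 0)" "A $$ (2, Suc 0) = B $$ (2, Suc 0)" "A $$ (2, 2) = B $$ (2, 2)"
  shows "A = B"
  using assms by (intro eq_matI) (auto simp: less_3_iff)

lemma mat_of_inject [simp]: "mat_of M = mat_of N \<longleftrightarrow> M = N"
proof
  assume eq: "mat_of M = mat_of N"
  obtain a b c d e f g h i where M: "M = ((a, b, c), (d, e, f), (g, h, i))"
    by (cases M rule: mat_of.cases)
  obtain a' b' c' d' e' f' g' h' i' where N: "N = ((a', b', c'), (d', e', f'), (g', h', i'))"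
    by (cases N rule: mat_of.cases)
  have "\<And>p. mat_of M $$ p = mat_of N $$ p" using eq by simp
  from this[of "(0, 0)"] this[of "(0, Suc 0)"] this[of "(0, 2)"]
    this[of "(Suc 0, 0)"] this[of "(Suc 0, Suc 0)"] this[of "(Suc 0, 2)"]
    this[of "(2, 0)"] this[of "(2, Suc 0)"] this[of "(2, 2)"]
  show "M = N" unfolding M N mat_of_index by (simp add: of_bool_eq_iff)
qed simp

lemma mat_of_surj:
  assumes "A \<in> carrier_mat 3 3"
  obtains M where "A = mat_of M"
proof -
  let ?b = "\<lambda>i j. A $$ (i, j) = 1"
  have b: "of_bool (x = 1) = x" for x :: bit by (cases x) auto
  have "A = mat_of ((?b 0 0, ?b 0 1, ?b 0 2), (?b 1 0, ?b 1 1, ?b 1 2), (?b 2 0, ?b 2 1, ?b 2 2))"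
    using assms by (intro eq_mat3I) (simp_all only: mat_of_index b mat_of_carrier One_nat_def)
  then show ?thesis by (rule that)
qed

lemma mat_of_zero: "mat_of bzero = 0\<^sub>m 3 3"
  unfolding bzero_def by (rule eq_mat3I) (simp_all add: mat_of_index)

lemma mat_of_one: "mat_of bone = 1\<^sub>m 3"
  unfolding bone_def by (rule eq_mat3I) (simp_all add: mat_of_index)

lemma of_bool_xor: "(of_bool (p \<noteq> q) :: bit) = of_bool p + of_bool q"
  by (cases p; cases q) simp_all

lemma mat_of_add: "mat_of (badd M N) = mat_of M + mat_of N"
proof -
  obtain a b c d e f g h i where M: "M = ((a, b, c), (d, e, f), (g, h, i))"
    by (cases M rule: mat_of.cases)
  obtain a' b' c' d' e' f' g' h' i' where N: "N = ((a', b', c'), (d', e', f'), (g', h', i'))"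
    by (cases N rule: mat_of.cases)
  have [simp]: "mat_of M + mat_of N \<in> carrier_mat 3 3" by simp
  show ?thesis
    by (rule eq_mat3I)
      (simp_all add: M N mat_of_index of_bool_xor carrier_matD[OF mat_of_carrier]
         del: add_bit_eq_xor)
qed

lemma row_times_bits:
  "row_times (a, b, c) ((d, e, f), (g, h, i), (k, l, m)) =
     ((a \<and> d) \<noteq> ((b \<and> g) \<noteq> (c \<and> k)), (a \<and> e) \<noteq> ((b \<and> h) \<noteq> (c \<and> l)),
      (a \<and> f) \<noteq> ((b \<and> i) \<noteq> (c \<and> m)))"
  by simp

lemma mat3_mult_index:
  assumes "A \<in> carrier_mat 3 3" "B \<in> carrier_mat 3 3" "i < 3" "j < 3"
  shows "(A * B) $$ (i, j) = A $$ (i, 0) * B $$ (0, j) + (A $$ (i, Suc 0) * B $$ (Suc 0, j) +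
    A $$ (i, 2) * B $$ (2, j))"
  using assms by (simp add: scalar_prod_def numeral_3_eq_3 numeral_2_eq_2 add.assoc)

lemma mat_of_mult: "mat_of (bmult M N) = mat_of M * mat_of N"
proof -
  obtain a b c d e f g h i where M: "M = ((a, b, c), (d, e, f), (g, h, i))"
    by (cases M rule: mat_of.cases)
  obtain a' b' c' d' e' f' g' h' i' where N: "N = ((a', b', c'), (d', e', f'), (g', h', i'))"
    by (cases N rule: mat_of.cases)
  have "mat_of M * mat_of N \<in> carrier_mat 3 3" by (rule mult_carrier_mat[of _ _ 3]) simp_all
  note [simp] = this[unfolded M N]
  show ?thesis
    by (rule eq_mat3I)
      (simp_all add: M N mat3_mult_index mat_of_index row_times_bits of_bool_xor of_bool_conj
         del: row_times.simps add_bit_eq_xor mult_bit_eq_and)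
qed

fun kills :: "bmat \<Rightarrow> bvec list \<Rightarrow> bool" where
  "kills M [] = False"
| "kills M (v # vs) = (if row_times v M = (False, False, False) then True else kills M vs)"

text \<open>
  The determinant decides invertibility: if it is one then the adjugate is the inverse, and if
  it is zero then some nonzero row vector is annihilated. All 512 matrices are checked.
\<close>

definition bdet_correct :: "bmat \<Rightarrow> bool" where
  "bdet_correct M =
     (if bdet M then (if bmult M (badj M) = bone then bmult (badj M) M = bone else False)
      else kills M (tl bvecs))"

lemma all_bdet_correct: "list_all bdet_correct bmats"
  by code_simp

lemma kills_D: "kills M vs \<Longrightarrow> \<exists>v \<in> set vs. row_times v M = (False, False, False)"
  by (induction M vs rule: kills.induct) (auto split: if_splits)

lemma set_bvecs [simp]: "set bvecs = UNIV"
  by (auto simp: bvecs_def)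

lemma set_bmats [simp]: "set bmats = UNIV"
  by (auto simp: bmats_def simp del: list.set)

lemma bmats_Cons: "bmats = bzero # tl bmats"
  by code_simp

lemma distinct_bmats: "distinct bmats"
proof -
  have "distinct bvecs" by (simp add: bvecs_def)
  then show ?thesis unfolding bmats_def by (intro distinct_product)
qed

lemma set_tl_bmats: "set (tl bmats) = - {bzero}"
  using distinct_bmats set_bmats bmats_Cons
  by (metis Compl_eq_Diff_UNIV Diff_insert_absorb distinct.simps(2) list.simps(15))

lemma zero_notin_tl_bvecs: "(False, False, False) \<notin> set (tl bvecs)"
  by (simp add: bvecs_def)

lemma bdet_correctD: "bdet_correct M"
  using all_bdet_correct unfolding list_all_iff set_bmats by blast

lemma badj_inverse:
  assumes "bdet P"
  shows "bmult P (badj P) = bone" "bmult (badj P) P = bone"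
  using assms bdet_correctD[of P] unfolding bdet_correct_def by (simp_all split: if_splits)

lemma mat_of_GL_iff: "mat_of P \<in> GL 3 \<longleftrightarrow> bdet P"
proof
  assume "bdet P"
  then have "mat_of P * mat_of (badj P) = 1\<^sub>m 3" "mat_of (badj P) * mat_of P = 1\<^sub>m 3"
    by (simp_all flip: mat_of_mult mat_of_one add: badj_inverse)
  then show "mat_of P \<in> GL 3" using GL_I mat_of_carrier by blast
next
  assume G: "mat_of P \<in> GL 3"
  show "bdet P"
  proof (rule ccontr)
    assume "\<not> bdet P"
    then have "kills P (tl bvecs)"
      using bdet_correctD[of P] by (simp add: bdet_correct_def)
    then obtain v where v: "v \<in> set (tl bvecs)" "row_times v P = (False, False, False)"
      using kills_D by blast
    define K where "K = (v, (False, False, False), (False, False, False))"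
    have "K \<noteq> bzero" using v(1) zero_notin_tl_bvecs by (auto simp: K_def bzero_def)
    have "bmult K P = bzero" using v(2) by (cases P) (auto simp: K_def bzero_def)
    then have "mat_of K * mat_of P = 0\<^sub>m 3 3" by (metis mat_of_mult mat_of_zero)
    moreover obtain Q where Q: "mat_of P * Q = 1\<^sub>m 3" "Q \<in> carrier_mat 3 3"
      using GL_E[OF G] by metis
    ultimately have "mat_of K * (mat_of P * Q) = 0\<^sub>m 3 3"
      by (metis assoc_mult_mat left_mult_zero_mat mat_of_carrier)
    then have "mat_of K = mat_of bzero" using Q mat_of_zero by (metis mat_of_carrier right_mult_one_mat)
    then show False using \<open>K \<noteq> bzero\<close> by simp
  qed
qed

text \<open>
  The laws of matrix algebra are inherited through the embedding \<open>mat_of\<close>.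
\<close>

lemma badd_comm: "badd M N = badd N M"
  by (simp flip: mat_of_inject add: mat_of_add comm_add_mat[of _ 3 3])

lemma badd_assoc: "badd (badd L M) N = badd L (badd M N)"
  by (simp flip: mat_of_inject add: mat_of_add assoc_add_mat[of _ 3 3])

lemma badd_self: "badd M M = bzero"
  by (cases M rule: mat_of.cases) (simp add: bzero_def)

lemma badd_zero [simp]: "badd bzero M = M" "badd M bzero = M"
  by (cases M rule: mat_of.cases, simp add: bzero_def)+

lemma badd_cancel [simp]: "badd M (badd M N) = N"
  by (simp flip: badd_assoc add: badd_self)

lemma badd_left_cancel: "badd M N = badd M N' \<longleftrightarrow> N = N'"
  by (metis badd_cancel)

lemma bmult_badd: "bmult L (badd M N) = badd (bmult L M) (bmult L N)"
  by (simp flip: mat_of_inject add: mat_of_add mat_of_mult mult_add_distrib_mat[of _ 3 3 _ 3])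

lemma badd_bmult: "bmult (badd M N) L = badd (bmult M L) (bmult N L)"
  by (simp flip: mat_of_inject add: mat_of_add mat_of_mult add_mult_distrib_mat[of _ 3 3 _ _ 3])

lemma bmult_bzero: "bmult M bzero = bzero"
  by (metis badd_self bmult_badd)

lemma bzero_bmult: "bmult bzero M = bzero"
  by (metis badd_self badd_bmult)

lemma bmult_assoc: "bmult (bmult L M) N = bmult L (bmult M N)"
  by (simp flip: mat_of_inject add: mat_of_mult assoc_mult_mat[of _ 3 3 _ 3 _ 3])

lemma bmult_bone [simp]: "bmult bone M = M" "bmult M bone = M"
  by (simp_all flip: mat_of_inject
      add: mat_of_mult mat_of_one left_mult_one_mat[of _ 3 3] right_mult_one_mat[of _ 3 3])

lemma bconj_badd: "bconj P (badd M N) = badd (bconj P M) (bconj P N)"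
  by (simp add: bmult_badd badd_bmult)

lemma mat_of_bconj: "mat_of (bconj P M) = mat_of P * mat_of M * mat_of (badj P)"
  by (simp add: mat_of_mult)

lemma one_plus_invertible_iff: "one_plus_invertible M \<longleftrightarrow> 1\<^sub>m 3 + mat_of M \<in> GL 3"
  by (simp add: one_plus_invertible_def flip: mat_of_one mat_of_add mat_of_GL_iff)

section \<open>The translation spaces as sets of Boolean matrices\<close>

fun in_NT :: "bmat \<Rightarrow> bool" where
  "in_NT ((a, b, c), (d, e, f), (g, h, i)) = (\<not> (a \<or> d \<or> e \<or> g \<or> h \<or> i))"

fun in_join21 :: "bmat \<Rightarrow> bool" where
  "in_join21 ((a, b, c), (d, e, f), (g, h, i)) = (\<not> (a \<or> g \<or> h \<or> i) \<and> d = b \<and> e = b)"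

fun in_join12 :: "bmat \<Rightarrow> bool" where
  "in_join12 ((a, b, c), (d, e, f), (g, h, i)) = (\<not> (a \<or> d \<or> e \<or> g) \<and> h = f \<and> i = f)"

fun in_T1 :: "bmat \<Rightarrow> bool" where
  "in_T1 ((a, b, c), (d, e, f), (g, h, i)) =
     (c = a \<and> d = a \<and> e = a \<and> h = a \<and> i = a \<and> g = (b \<noteq> f))"

fun in_T2 :: "bmat \<Rightarrow> bool" where
  "in_T2 ((a, b, c), (d, e, f), (g, h, i)) =
     (c = a \<and> d = a \<and> e = a \<and> h = a \<and> i = a \<and> \<not> g)"

definition transvection :: bmat where
  "transvection = ((True, False, False), (False, True, True), (False, False, True))"

text \<open>
  Since the transvection is its own inverse, this is the space of the products of the
  transvection with the elements of \<open>T2\<close>. The transvection lies in \<open>I + T2\<close>, so the space is the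
  translation space that \<open>I + T2\<close> obtains when this element is moved to the identity matrix.
\<close>

definition in_T2_shifted :: "bmat \<Rightarrow> bool" where
  "in_T2_shifted M = in_T2 (bmult transvection M)"

definition representatives :: "(bmat \<Rightarrow> bool) list" where
  "representatives = [in_NT, in_join21, in_join12, in_T1, in_T2]"

definition models :: "(bmat \<Rightarrow> bool) list" where
  "models = representatives @ [in_T2_shifted]"

definition space_of :: "(bmat \<Rightarrow> bool) \<Rightarrow> bit mat set" where
  "space_of T = mat_of ` Collect T"

lemma mat_of_in_space_of [simp]: "mat_of M \<in> space_of T \<longleftrightarrow> T M"
  by (auto simp: space_of_def)

lemma NT_eq: "NT 3 = space_of in_NT"
proof -
  have "mat_of M \<in> NT 3 \<longleftrightarrow> in_NT M" for M
    by (cases M rule: mat_of.cases)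
      (auto simp: NT_def less_3_iff mat_of_index carrier_matD[OF mat_of_carrier])
  moreover have "NT 3 \<subseteq> carrier_mat 3 3" by (auto simp: NT_def)
  ultimately show ?thesis unfolding space_of_def by (auto elim!: mat_of_surj)
qed

lemma lin_span_singleton:
  fixes A :: "'a::field mat"
  assumes "A \<in> carrier_mat n n"
  shows "lin_span n {A} = range (\<lambda>c. c \<cdot>\<^sub>m A)"
proof -
  interpret V: vectorspace class_ring "module_mat TYPE('a) n n" by (rule matrix_vs)
  have "V.lincomb a {A} = a A \<cdot>\<^sub>m A" for a
    unfolding V.lincomb_def using assms by (simp add: matrix_vs_simps)
  then have "lin_span n {A} = {a A \<cdot>\<^sub>m A | a. True}"
    unfolding lin_span_def using V.finite_span[of "{A}"] assms by (simp add: matrix_vs_simps)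
  also have "\<dots> = range (\<lambda>c. c \<cdot>\<^sub>m A)" by (auto intro: exI[of _ "\<lambda>_. c" for c])
  finally show ?thesis .
qed

lemma of_bool_eq_one [simp]: "of_bool (x = 1) = x" for x :: bit
  by (cases x) auto

lemma span_C: "lin_span 2 {C} = range (\<lambda>t. of_bool t \<cdot>\<^sub>m C)"
proof -
  have "C \<in> carrier_mat 2 2" by (simp add: C_def mat_of_rows_list_def numeral_2_eq_2)
  moreover have "range (\<lambda>t. of_bool t \<cdot>\<^sub>m C) = range (\<lambda>c. c \<cdot>\<^sub>m C)"
  proof (intro equalityI subsetI)
    fix X assume "X \<in> range (\<lambda>c. c \<cdot>\<^sub>m C)"
    then obtain c where "X = c \<cdot>\<^sub>m C" by blast
    then have "X = of_bool (c = 1) \<cdot>\<^sub>m C" by simp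
    then show "X \<in> range (\<lambda>t. of_bool t \<cdot>\<^sub>m C)" by blast
  qed blast
  ultimately show ?thesis by (simp add: lin_span_singleton)
qed

lemma C_index:
  "dim_row C = 2" "dim_col C = 2"
  "C $$ (0, 0) = 0" "C $$ (0, Suc 0) = 1" "C $$ (Suc 0, 0) = 1" "C $$ (Suc 0, Suc 0) = 1"
  by (simp_all add: C_def mat_of_rows_list_def)

lemma four_block_21:
  assumes "D \<in> carrier_mat 2 1"
  shows "four_block_mat (of_bool t \<cdot>\<^sub>m C) D (0\<^sub>m 1 2) (0\<^sub>m 1 1) =
    mat_of ((False, t, D $$ (0, 0) = 1), (t, t, D $$ (Suc 0, 0) = 1), (False, False, False))"
  using assms
  by (cases t; intro eq_mat3I carrier_matI) (simp_all add: mat_of_index C_index carrier_matD[OF mat_of_carrier])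

lemma join21_eq: "join 2 1 (lin_span 2 {C}) {0\<^sub>m 1 1} = space_of in_join21"
proof (intro equalityI subsetI)
  fix X assume "X \<in> join 2 1 (lin_span 2 {C}) {0\<^sub>m 1 1}"
  then obtain t D where "D \<in> carrier_mat 2 1"
    and "X = four_block_mat (of_bool t \<cdot>\<^sub>m C) D (0\<^sub>m 1 2) (0\<^sub>m 1 1)"
    by (auto simp: join_def span_C)
  then show "X \<in> space_of in_join21" by (simp only: four_block_21) simp
next
  fix X assume "X \<in> space_of in_join21"
  then obtain a t x d e y g h i where "X = mat_of ((a, t, x), (d, e, y), (g, h, i))"
    and "in_join21 ((a, t, x), (d, e, y), (g, h, i))"
    by (auto simp: space_of_def simp del: in_join21.simps)
  then have X: "X = mat_of ((False, t, x), (t, t, y), (False, False, False))" by simp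
  define D :: "bit mat" where "D = mat 2 1 (\<lambda>(i, j). of_bool (if i = 0 then x else y))"
  have "D \<in> carrier_mat 2 1" by (simp add: D_def)
  moreover have "X = four_block_mat (of_bool t \<cdot>\<^sub>m C) D (0\<^sub>m 1 2) (0\<^sub>m 1 1)"
    by (subst four_block_21) (auto simp: D_def X)
  ultimately show "X \<in> join 2 1 (lin_span 2 {C}) {0\<^sub>m 1 1}"
    unfolding join_def span_C by blast
qed

lemma four_block_12:
  assumes "D \<in> carrier_mat 1 2"
  shows "four_block_mat (0\<^sub>m 1 1) D (0\<^sub>m 2 1) (of_bool t \<cdot>\<^sub>m C) =
    mat_of ((False, D $$ (0, 0) = 1, D $$ (0, Suc 0) = 1), (False, False, t), (False, t, t))"
  using assms
  by (cases t; intro eq_mat3I carrier_matI) (simp_all add: mat_of_index C_index carrier_matD[OF mat_of_carrier])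

lemma join12_eq: "join 1 2 {0\<^sub>m 1 1} (lin_span 2 {C}) = space_of in_join12"
proof (intro equalityI subsetI)
  fix X assume "X \<in> join 1 2 {0\<^sub>m 1 1} (lin_span 2 {C})"
  then obtain t D where "D \<in> carrier_mat 1 2"
    and "X = four_block_mat (0\<^sub>m 1 1) D (0\<^sub>m 2 1) (of_bool t \<cdot>\<^sub>m C)"
    by (auto simp: join_def span_C)
  then show "X \<in> space_of in_join12" by (simp only: four_block_12) simp
next
  fix X assume "X \<in> space_of in_join12"
  then obtain a x y d e t g h i where "X = mat_of ((a, x, y), (d, e, t), (g, h, i))"
    and "in_join12 ((a, x, y), (d, e, t), (g, h, i))"
    by (auto simp: space_of_def simp del: in_join12.simps)
  then have X: "X = mat_of ((False, x, y), (False, False, t), (False, t, t))" by simp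
  define D :: "bit mat" where "D = mat 1 2 (\<lambda>(i, j). of_bool (if j = 0 then x else y))"
  have "D \<in> carrier_mat 1 2" by (simp add: D_def)
  moreover have "X = four_block_mat (0\<^sub>m 1 1) D (0\<^sub>m 2 1) (of_bool t \<cdot>\<^sub>m C)"
    by (subst four_block_12) (auto simp: D_def X)
  ultimately show "X \<in> join 1 2 {0\<^sub>m 1 1} (lin_span 2 {C})"
    unfolding join_def span_C by blast
qed

lemma T1_eq: "T1 = space_of in_T1"
proof (intro equalityI subsetI)
  fix X assume "X \<in> T1"
  then obtain a b c where X: "X = mat_of_rows_list 3 [[a, b, a], [a, a, c], [b + c, a, a]]"
    by (auto simp: T1_def)
  have "X = mat_of ((a = 1, b = 1, a = 1), (a = 1, a = 1, c = 1), ((b = 1) \<noteq> (c = 1), a = 1, a = 1))"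
    unfolding X mat_of.simps of_bool_xor of_bool_eq_one by simp
  then show "X \<in> space_of in_T1" by (simp)
next
  fix X assume "X \<in> space_of in_T1"
  then obtain a b c where X: "X = mat_of ((a, b, a), (a, a, c), (b \<noteq> c, a, a))"
    by (auto simp: space_of_def elim!: in_T1.elims)
  then show "X \<in> T1" unfolding T1_def X mat_of.simps of_bool_xor by blast
qed

lemma T2_eq: "T2 = space_of in_T2"
proof (intro equalityI subsetI)
  fix X assume "X \<in> T2"
  then obtain a b c where X: "X = mat_of_rows_list 3 [[a, b, a], [a, a, c], [0, a, a]]"
    by (auto simp: T2_def)
  have "X = mat_of ((a = 1, b = 1, a = 1), (a = 1, a = 1, c = 1), (False, a = 1, a = 1))"
    unfolding X mat_of.simps of_bool_eq_one by simp
  then show "X \<in> space_of in_T2" by (simp)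
next
  fix X assume "X \<in> space_of in_T2"
  then obtain a b c where "X = mat_of ((a, b, a), (a, a, c), (False, a, a))"
    by (auto simp: space_of_def elim!: in_T2.elims)
  then have "X = mat_of_rows_list 3 [[of_bool a, of_bool b, of_bool a],
      [of_bool a, of_bool a, of_bool c], [0, of_bool a, of_bool a]]" by (simp add: mat_of.simps)
  then show "X \<in> T2" unfolding T2_def by blast
qed

lemma translation_spaces_eq:
  "translation_spaces = map space_of representatives"
  unfolding representatives_def translation_spaces_def NT_eq join21_eq join12_eq T1_eq T2_eq by simp

lemma in_models_cases:
  assumes "T \<in> set models"
  obtains "T = in_NT" | "T = in_join21" | "T = in_join12" | "T = in_T1" | "T = in_T2" | "T = in_T2_shifted"
  using assms by (auto simp: models_def representatives_def)

lemma in_T2_badd: "in_T2 M \<Longrightarrow> in_T2 N \<Longrightarrow> in_T2 (badd M N)"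
  by (cases M rule: mat_of.cases; cases N rule: mat_of.cases) simp

lemma model_subspace:
  assumes "T \<in> set models"
  shows model_zero: "T bzero" and model_add: "T M \<Longrightarrow> T N \<Longrightarrow> T (badd M N)"
proof -
  show "T bzero"
    using assms by (cases rule: in_models_cases) (simp_all add: bzero_def in_T2_shifted_def transvection_def)
  show "T (badd M N)" if "T M" "T N"
    using assms
  proof (cases rule: in_models_cases)
    case 6
    then show ?thesis using that by (simp add: in_T2_shifted_def bmult_badd in_T2_badd)
  qed (use that in \<open>cases M rule: mat_of.cases; cases N rule: mat_of.cases; auto\<close>)+
qed

lemma model_counts:
  "length (filter in_NT bmats) = 8" "length (filter in_join21 bmats) = 8"
  "length (filter in_join12 bmats) = 8" "length (filter in_T1 bmats) = 8"
  "length (filter in_T2 bmats) = 8" "length (filter in_T2_shifted bmats) = 8"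
  by code_simp+

lemma card_model:
  assumes "T \<in> set models"
  shows "card (Collect T) = 8"
proof -
  have "Collect T = set (filter T bmats)" by simp
  then have "card (Collect T) = length (filter T bmats)"
    using distinct_bmats distinct_card distinct_filter by metis
  then show ?thesis using model_counts by (cases rule: in_models_cases[OF assms]) simp_all
qed

lemma model_lin_subspace:
  assumes "T \<in> set models"
  shows "lin_subspace 3 (space_of T)" and "lin_dim 3 (space_of T) = 3"
proof -
  show sub: "lin_subspace 3 (space_of T)"
    unfolding lin_subspace_bit_iff
  proof (intro conjI ballI)
    show "space_of T \<subseteq> carrier_mat 3 3" by (auto simp: space_of_def)
    show "0\<^sub>m 3 3 \<in> space_of T" using model_zero[OF assms] by (simp flip: mat_of_zero)
  next
    fix X Y assume "X \<in> space_of T" "Y \<in> space_of T"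
    then show "X + Y \<in> space_of T"
      unfolding space_of_def using model_add[OF assms] by (auto simp flip: mat_of_add)
  qed
  have "inj_on mat_of (Collect T)" by (auto intro: inj_onI)
  then have "card (space_of T) = 2 ^ 3" by (simp add: space_of_def card_image card_model assms)
  then have "(2::nat) ^ lin_dim 3 (space_of T) = 2 ^ 3" using card_bit_subspace[OF sub] by simp
  then show "lin_dim 3 (space_of T) = 3" by (simp only: power_inject_exp)
qed

lemma model_one_plus_invertible:
  assumes "T \<in> set representatives" "T M"
  shows "one_plus_invertible M"
proof -
  have "in_NT M \<Longrightarrow> one_plus_invertible M" "in_join21 M \<Longrightarrow> one_plus_invertible M" "in_join12 M \<Longrightarrow> one_plus_invertible M"
    "in_T1 M \<Longrightarrow> one_plus_invertible M" "in_T2 M \<Longrightarrow> one_plus_invertible M"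
    by (cases M rule: mat_of.cases; auto simp: one_plus_invertible_def bone_def)+
  then show ?thesis using assms by (auto simp: representatives_def)
qed

section \<open>The five spaces are pairwise inequivalent\<close>

definition right_degenerate :: "nat \<Rightarrow> 'a::field mat set \<Rightarrow> bool" where
  "right_degenerate n W \<longleftrightarrow>
     (\<exists>K \<in> carrier_mat n n. K \<noteq> 0\<^sub>m n n \<and> (\<forall>X \<in> W. X * K = 0\<^sub>m n n))"

definition left_degenerate :: "nat \<Rightarrow> 'a::field mat set \<Rightarrow> bool" where
  "left_degenerate n W \<longleftrightarrow>
     (\<exists>K \<in> carrier_mat n n. K \<noteq> 0\<^sub>m n n \<and> (\<forall>X \<in> W. K * X = 0\<^sub>m n n))"

text \<open>
  Transposition exchanges the first two entries. Only these two tell the two joins apart, which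
  are transposes of each other up to equivalence.
\<close>

definition signature :: "nat \<Rightarrow> 'a::field mat set \<Rightarrow> bool \<times> bool \<times> bool" where
  "signature n W = (right_degenerate n W, left_degenerate n W, W \<inter> GL n \<noteq> {})"

text \<open>
  If \<open>X K = 0\<close> for all \<open>X\<close>, then \<open>K\<close> multiplied from the left by the inverse of \<open>Q\<close> is annihilated by
  all \<open>P X Q\<close>.
\<close>

lemma right_degenerate_image:
  fixes W :: "'a::field mat set"
  assumes W: "W \<subseteq> carrier_mat n n" and eq: "equivalent_sets n W U" and "right_degenerate n W"
  shows "right_degenerate n U"
proof -
  obtain P Q where PQ: "P \<in> GL n" "Q \<in> GL n" and U: "U = (\<lambda>X. P * X * Q) ` W"
    using eq by (auto simp: equivalent_sets_def)
  have P: "P \<in> carrier_mat n n" by (rule GL_carrier[OF PQ(1)])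
  obtain Q' where Q: "Q * Q' = 1\<^sub>m n" "Q \<in> carrier_mat n n" "Q' \<in> carrier_mat n n"
    using GL_E[OF PQ(2)] by metis
  obtain K where K: "K \<in> carrier_mat n n" "K \<noteq> 0\<^sub>m n n" "\<And>X. X \<in> W \<Longrightarrow> X * K = 0\<^sub>m n n"
    using assms(3) by (auto simp: right_degenerate_def)
  have QK: "Q * (Q' * K) = K" using Q K(1) by (simp flip: assoc_mult_mat[of _ n n _ n _ n])
  have "P * X * Q * (Q' * K) = 0\<^sub>m n n" if "X \<in> W" for X
  proof -
    have X: "X \<in> carrier_mat n n" using that W by auto
    have "P * X * Q * (Q' * K) = P * (X * (Q * (Q' * K)))"
      using P Q(2,3) K(1) X by (simp add: assoc_mult_mat[of _ n n _ n _ n] mult_carrier_mat[of _ n n _ n])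
    then show ?thesis using QK K(3)[OF that] P by simp
  qed
  moreover have "Q' * K \<noteq> 0\<^sub>m n n" using QK K(2) Q(2) by auto
  moreover have "Q' * K \<in> carrier_mat n n" using Q K by simp
  ultimately show ?thesis unfolding right_degenerate_def U by blast
qed

text \<open>
  The same argument with the inverse of \<open>P\<close> on the other side.
\<close>

lemma left_degenerate_image:
  fixes W :: "'a::field mat set"
  assumes W: "W \<subseteq> carrier_mat n n" and eq: "equivalent_sets n W U" and "left_degenerate n W"
  shows "left_degenerate n U"
proof -
  obtain P Q where PQ: "P \<in> GL n" "Q \<in> GL n" and U: "U = (\<lambda>X. P * X * Q) ` W"
    using eq by (auto simp: equivalent_sets_def)
  have Q: "Q \<in> carrier_mat n n" by (rule GL_carrier[OF PQ(2)])
  obtain P' where P: "P' * P = 1\<^sub>m n" "P \<in> carrier_mat n n" "P' \<in> carrier_mat n n"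
    using GL_E[OF PQ(1)] by metis
  obtain K where K: "K \<in> carrier_mat n n" "K \<noteq> 0\<^sub>m n n" "\<And>X. X \<in> W \<Longrightarrow> K * X = 0\<^sub>m n n"
    using assms(3) by (auto simp: left_degenerate_def)
  have KP: "K * P' * P = K" using P K(1) by (simp add: assoc_mult_mat[of _ n n _ n _ n])
  have "K * P' * (P * X * Q) = 0\<^sub>m n n" if "X \<in> W" for X
  proof -
    have X: "X \<in> carrier_mat n n" using that W by auto
    have "K * P' * (P * X * Q) = K * P' * P * X * Q"
      using P(2,3) Q K(1) X by (simp add: assoc_mult_mat[of _ n n _ n _ n] mult_carrier_mat[of _ n n _ n])
    then show ?thesis using KP K(3)[OF that] Q by simp
  qed
  moreover have "K * P' \<noteq> 0\<^sub>m n n" using KP K(2) P(2) by auto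
  moreover have "K * P' \<in> carrier_mat n n" using P K by simp
  ultimately show ?thesis unfolding left_degenerate_def U by blast
qed

lemma meets_GL_image:
  fixes W :: "'a::field mat set"
  assumes "equivalent_sets n W U" and "W \<inter> GL n \<noteq> {}"
  shows "U \<inter> GL n \<noteq> {}"
  using assms GL_mult unfolding equivalent_sets_def by blast

lemma signature_equivalent:
  fixes W :: "'a::field mat set"
  assumes W: "W \<subseteq> carrier_mat n n" and U: "U \<subseteq> carrier_mat n n" and eq: "equivalent_sets n W U"
  shows "signature n W = signature n U"
proof -
  have eq': "equivalent_sets n U W" by (rule equivalent_sets_sym[OF eq W])
  have "right_degenerate n W = right_degenerate n U"
    using right_degenerate_image[OF W eq] right_degenerate_image[OF U eq'] by blast
  moreover have "left_degenerate n W = left_degenerate n U"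
    using left_degenerate_image[OF W eq] left_degenerate_image[OF U eq'] by blast
  moreover have "(W \<inter> GL n \<noteq> {}) = (U \<inter> GL n \<noteq> {})"
    using meets_GL_image[OF eq] meets_GL_image[OF eq'] by blast
  ultimately show ?thesis by (simp only: signature_def)
qed

lemma bex_carrier_mat_3: "(\<exists>K \<in> carrier_mat 3 3. P K) \<longleftrightarrow> (\<exists>K. P (mat_of K))"
  by (metis mat_of_surj mat_of_carrier)

lemma signature_space_of:
  "signature 3 (space_of T) =
    ((\<exists>K. K \<noteq> bzero \<and> (\<forall>M. T M \<longrightarrow> bmult M K = bzero)),
     (\<exists>K. K \<noteq> bzero \<and> (\<forall>M. T M \<longrightarrow> bmult K M = bzero)),
     (\<exists>M. T M \<and> bdet M))"
proof -
  have "space_of T \<inter> GL 3 \<noteq> {} \<longleftrightarrow> (\<exists>M. T M \<and> bdet M)"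
    unfolding space_of_def using mat_of_GL_iff by blast
  moreover have "(\<forall>X \<in> space_of T. P X) \<longleftrightarrow> (\<forall>M. T M \<longrightarrow> P (mat_of M))" for P
    unfolding space_of_def by blast
  ultimately show ?thesis
    unfolding signature_def right_degenerate_def left_degenerate_def bex_carrier_mat_3
    by (simp only: mat_of_mult[symmetric] mat_of_zero[symmetric] mat_of_inject)
qed

lemma signature_NT: "signature 3 (space_of in_NT) = (True, True, False)"
proof -
  \<comment> \<open>the first column and the last row vanish\<close>
  let ?R = "((True, False, False), (False, False, False), (False, False, False))"
  let ?L = "((False, False, True), (False, False, False), (False, False, False))"
  have "bmult M ?R = bzero" "bmult ?L M = bzero" "\<not> bdet M" if "in_NT M" for M
    using that by (cases M rule: mat_of.cases; simp add: bzero_def)+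
  moreover have "?R \<noteq> bzero" "?L \<noteq> bzero" by (simp_all add: bzero_def)
  ultimately have "(\<exists>K. K \<noteq> bzero \<and> (\<forall>M. in_NT M \<longrightarrow> bmult M K = bzero))"
    "(\<exists>K. K \<noteq> bzero \<and> (\<forall>M. in_NT M \<longrightarrow> bmult K M = bzero))"
    "\<not> (\<exists>M. in_NT M \<and> bdet M)"
    by blast+
  then show ?thesis by (simp only: signature_space_of)
qed

text \<open>
  The matrices of the block \<open>C\<close> and of the unit in the upper right corner already have no common
  right annihilator.
\<close>

lemma signature_join21: "signature 3 (space_of in_join21) = (False, True, False)"
proof -
  let ?L = "((False, False, True), (False, False, False), (False, False, False))"
  have "bmult ?L M = bzero" "\<not> bdet M" if "in_join21 M" for M
    using that by (cases M rule: mat_of.cases; simp add: bzero_def)+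
  moreover have "?L \<noteq> bzero" by (simp add: bzero_def)
  moreover have "K = bzero" if "\<And>M. in_join21 M \<Longrightarrow> bmult M K = bzero" for K
    using that[of "((False, True, False), (True, True, False), (False, False, False))"]
      that[of "((False, False, True), (False, False, False), (False, False, False))"]
    by (cases K rule: mat_of.cases) (auto simp: bzero_def split: if_splits)
  ultimately have "\<not> (\<exists>K. K \<noteq> bzero \<and> (\<forall>M. in_join21 M \<longrightarrow> bmult M K = bzero))"
    "(\<exists>K. K \<noteq> bzero \<and> (\<forall>M. in_join21 M \<longrightarrow> bmult K M = bzero))"
    "\<not> (\<exists>M. in_join21 M \<and> bdet M)"
    by blast+
  then show ?thesis by (simp only: signature_space_of)
qed

text \<open>
  The block \<open>C\<close> and one matrix unit already have no common left annihilator.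
\<close>

lemma signature_join12: "signature 3 (space_of in_join12) = (True, False, False)"
proof -
  let ?R = "((True, False, False), (False, False, False), (False, False, False))"
  have "bmult M ?R = bzero" "\<not> bdet M" if "in_join12 M" for M
    using that by (cases M rule: mat_of.cases; simp add: bzero_def)+
  moreover have "?R \<noteq> bzero" by (simp add: bzero_def)
  moreover have "K = bzero" if "\<And>M. in_join12 M \<Longrightarrow> bmult K M = bzero" for K
    using that[of "((False, False, False), (False, False, True), (False, True, True))"]
      that[of "((False, True, False), (False, False, False), (False, False, False))"]
    by (cases K rule: mat_of.cases) (auto simp: bzero_def split: if_splits)
  ultimately have "(\<exists>K. K \<noteq> bzero \<and> (\<forall>M. in_join12 M \<longrightarrow> bmult M K = bzero))"
    "\<not> (\<exists>K. K \<noteq> bzero \<and> (\<forall>M. in_join12 M \<longrightarrow> bmult K M = bzero))"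
    "\<not> (\<exists>M. in_join12 M \<and> bdet M)"
    by blast+
  then show ?thesis by (simp only: signature_space_of)
qed

text \<open>
  Every element is singular, but two of them have no common annihilator on either side.
\<close>

lemma signature_T1: "signature 3 (space_of in_T1) = (False, False, False)"
proof -
  let ?B = "((False, True, False), (False, False, False), (True, False, False))"
  let ?C = "((False, False, False), (False, False, True), (True, False, False))"
  have "\<not> bdet M" if "in_T1 M" for M
    using that by (cases M rule: mat_of.cases) auto
  moreover have "K = bzero" if "\<And>M. in_T1 M \<Longrightarrow> bmult M K = bzero" for K
    using that[of ?B] that[of ?C]
    by (cases K rule: mat_of.cases) (auto simp: bzero_def split: if_splits)
  moreover have "K = bzero" if "\<And>M. in_T1 M \<Longrightarrow> bmult K M = bzero" for K
    using that[of ?B] that[of ?C]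
    by (cases K rule: mat_of.cases) (auto simp: bzero_def split: if_splits)
  ultimately have "\<not> (\<exists>K. K \<noteq> bzero \<and> (\<forall>M. in_T1 M \<longrightarrow> bmult M K = bzero))"
    "\<not> (\<exists>K. K \<noteq> bzero \<and> (\<forall>M. in_T1 M \<longrightarrow> bmult K M = bzero))"
    "\<not> (\<exists>M. in_T1 M \<and> bdet M)"
    by blast+
  then show ?thesis by (simp only: signature_space_of)
qed

text \<open>
  One invertible element settles all three entries, as it has no annihilator.
\<close>

lemma signature_T2: "signature 3 (space_of in_T2) = (False, False, True)"
proof -
  let ?U = "((True, True, True), (True, True, False), (False, True, True))"
  have U: "in_T2 ?U" "bdet ?U" by simp_all
  have "K = bzero" if "bmult ?U K = bzero" for K
  proof -
    have "K = bmult (badj ?U) (bmult ?U K)"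
      by (simp only: bmult_assoc[symmetric] badj_inverse(2)[OF U(2)] bmult_bone)
    then show ?thesis by (simp only: that bmult_bzero)
  qed
  moreover have "K = bzero" if "bmult K ?U = bzero" for K
  proof -
    have "K = bmult (bmult K ?U) (badj ?U)"
      by (simp only: bmult_assoc badj_inverse(1)[OF U(2)] bmult_bone)
    then show ?thesis by (simp only: that bzero_bmult)
  qed
  ultimately have "\<not> (\<exists>K. K \<noteq> bzero \<and> (\<forall>M. in_T2 M \<longrightarrow> bmult M K = bzero))"
    "\<not> (\<exists>K. K \<noteq> bzero \<and> (\<forall>M. in_T2 M \<longrightarrow> bmult K M = bzero))"
    "(\<exists>M. in_T2 M \<and> bdet M)"
    using U by blast+
  then show ?thesis by (simp only: signature_space_of)
qed

lemma signatures_distinct: "distinct (map (signature 3) translation_spaces)"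
  by (simp add: translation_spaces_eq representatives_def signature_NT signature_join21
      signature_join12 signature_T1 signature_T2)

lemma translation_spaces_subspace:
  assumes "H \<in> set translation_spaces"
  shows "lin_subspace 3 H"
  using assms model_lin_subspace(1) by (auto simp: translation_spaces_eq models_def)

lemma inequivalent_translation_spaces:
  assumes "i < 5" "j < 5" "i \<noteq> j"
  shows "\<not> equivalent_sets 3 (translate (1\<^sub>m 3) (translation_spaces ! i))
                             (translate (1\<^sub>m 3) (translation_spaces ! j))"
proof
  assume eq: "equivalent_sets 3 (translate (1\<^sub>m 3) (translation_spaces ! i))
                            (translate (1\<^sub>m 3) (translation_spaces ! j))"
  have len: "length translation_spaces = 5"
    by (simp add: translation_spaces_eq representatives_def)
  have sub: "lin_subspace 3 (translation_spaces ! i)" "lin_subspace 3 (translation_spaces ! j)"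
    using assms len by (simp_all add: translation_spaces_subspace)
  have "equivalent_sets 3 (translation_spaces ! i) (translation_spaces ! j)"
    by (rule equivalent_translates[OF one_carrier_mat sub(1) one_carrier_mat sub(2) eq])
  moreover have "translation_spaces ! i \<subseteq> carrier_mat 3 3" "translation_spaces ! j \<subseteq> carrier_mat 3 3"
    using sub by (simp_all add: lin_subspace_iff)
  ultimately have "signature 3 (translation_spaces ! i) = signature 3 (translation_spaces ! j)"
    using signature_equivalent by blast
  then have "map (signature 3) translation_spaces ! i = map (signature 3) translation_spaces ! j"
    using assms len by simp
  then show False
    using nth_eq_iff_index_eq[OF signatures_distinct] assms len by simp
qed

section \<open>A normal form for one element\<close>

text \<open>
  Matrices and conjugates are treated as opaque from here on; quantifiers over matrices are not
  to be split into quantifiers over their entries.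
\<close>

declare split_paired_All [simp del] split_paired_Ex [simp del] bconj.simps [simp del]

definition unit12 :: bmat where
  "unit12 = ((False, True, False), (False, False, False), (False, False, False))"

fun companion :: "bvec \<Rightarrow> bmat" where
  "companion c = ((False, True, False), (False, False, True), c)"

text \<open>
  The normal forms of the nonzero matrices without eigenvalue one. With last row \<open>(p, q, r)\<close> the
  companion matrix has characteristic polynomial \<open>x\<^sup>3 + r x\<^sup>2 + q x + p\<close>, which does not vanish at
  one exactly if an even number of \<open>p, q, r\<close> are one. The four companion matrices belong to
  \<open>x\<^sup>3\<close>, \<open>x (x\<^sup>2 + x + 1)\<close>, \<open>x\<^sup>3 + x\<^sup>2 + 1\<close> and \<open>x\<^sup>3 + x + 1\<close>.
\<close>

definition normal_form :: "bmat \<Rightarrow> bool" where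
  "normal_form M \<longleftrightarrow> M = unit12 \<or> M = companion (False, False, False) \<or>
     M = companion (False, True, True) \<or> M = companion (True, False, True) \<or>
     M = companion (True, True, False)"

text \<open>
  If \<open>P M = N P\<close> for a normal form \<open>N\<close>, then comparing first rows shows that the second row of \<open>P\<close> is
  its first row times \<open>M\<close>, because the first row of \<open>N\<close> is \<open>(0, 1, 0)\<close>. So only the first row \<open>r\<close> and
  the last row \<open>t\<close> of \<open>P\<close> have to be searched for. Here and below, conditionals take the place of
  connectives because rewriting evaluates only the branch that is needed.
\<close>

fun normalised_with :: "bmat \<Rightarrow> bvec \<Rightarrow> bvec list \<Rightarrow> bool" where
  "normalised_with M r [] = False"
| "normalised_with M r (t # ts) =
     (let P = (r, row_times r M, t)
      in if (if bdet P then normal_form (bconj P M) else False) then True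
         else normalised_with M r ts)"

fun normalised_from :: "bmat \<Rightarrow> bvec list \<Rightarrow> bool" where
  "normalised_from M [] = False"
| "normalised_from M (r # rs) =
     (if normalised_with M r bvecs then True else normalised_from M rs)"

definition normalisable :: "bmat \<Rightarrow> bool" where
  "normalisable M = (if one_plus_invertible M then normalised_from M bvecs else True)"

lemma all_normalisable: "list_all normalisable (tl bmats)"
  by code_simp

lemma normalised_withD: "normalised_with M r ts \<Longrightarrow> \<exists>P. bdet P \<and> normal_form (bconj P M)"
proof (induction ts)
  case (Cons t ts)
  then show ?case by (simp only: normalised_with.simps Let_def split: if_split_asm) blast+
qed simp

lemma normalised_fromD: "normalised_from M rs \<Longrightarrow> \<exists>P. bdet P \<and> normal_form (bconj P M)"
proof (induction rs)
  case (Cons r rs)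
  then show ?case by (simp only: normalised_from.simps split: if_split_asm) (blast dest: normalised_withD)+
qed simp

lemma conjugate_to_normal_form:
  assumes "one_plus_invertible M" "M \<noteq> bzero"
  shows "\<exists>P. bdet P \<and> normal_form (bconj P M)"
proof -
  have "normalisable M" using all_normalisable assms(2) by (simp add: list_all_iff set_tl_bmats)
  then show ?thesis using assms(1) normalised_fromD by (simp add: normalisable_def)
qed

section \<open>The search over complementary planes\<close>

fun entry12_zero :: "bmat \<Rightarrow> bool" where
  "entry12_zero ((a, b, c), r, s) = (\<not> b)"

text \<open>
  The three functions list the invertible \<open>P\<close> that conjugate \<open>M\<close> into \<open>T\<close>, one row of \<open>P\<close> at a time;
  no long list of matrices has to be carried through the rewriting.
\<close>

fun with_last_row where
  "with_last_row M T r s [] = []"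
| "with_last_row M T r s (t # ts) =
     (if (if bdet (r, s, t) then T (bconj (r, s, t) M) else False)
      then (r, s, t) # with_last_row M T r s ts else with_last_row M T r s ts)"

fun with_middle_row where
  "with_middle_row M T r [] = []"
| "with_middle_row M T r (s # ss) = with_last_row M T r s bvecs @ with_middle_row M T r ss"

fun with_first_row :: "bmat \<Rightarrow> (bmat \<Rightarrow> bool) \<Rightarrow> bvec list \<Rightarrow> bmat list" where
  "with_first_row M T [] = []"
| "with_first_row M T (r # rs) = with_middle_row M T r bvecs @ with_first_row M T rs"

text \<open>
  These depend on \<open>M\<close> only, so they are computed once and then tried on all planes.
\<close>

definition conjugators :: "bmat \<Rightarrow> ((bmat \<Rightarrow> bool) \<times> bmat list) list" where
  "conjugators M = map (\<lambda>T. (T, with_first_row M T bvecs)) models"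

text \<open>
  The nonzero matrices that can occur together with \<open>M\<close> in the complementary plane.
\<close>

definition partners :: "bmat \<Rightarrow> bmat list" where
  "partners M = filter (\<lambda>X. if one_plus_invertible X then one_plus_invertible (badd M X) else False)
     (filter entry12_zero (tl bmats))"

fun some_conjugates :: "(bmat \<Rightarrow> bool) \<Rightarrow> bmat \<Rightarrow> bmat \<Rightarrow> bmat list \<Rightarrow> bool" where
  "some_conjugates T X Y [] = False"
| "some_conjugates T X Y (P # Ps) =
     (if (if T (bconj P X) then T (bconj P Y) else False) then True
      else some_conjugates T X Y Ps)"

fun recognised :: "((bmat \<Rightarrow> bool) \<times> bmat list) list \<Rightarrow> bmat \<Rightarrow> bmat \<Rightarrow> bool" where
  "recognised [] X Y = False"
| "recognised ((T, Ps) # cs) X Y =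
     (if some_conjugates T X Y Ps then True else recognised cs X Y)"

text \<open>
  For \<open>X\<close> and \<open>Y\<close> among the partners of \<open>M\<close>, this is the rest of the condition that \<open>I\<close> plus the span
  of \<open>M, X, Y\<close> consists of invertible matrices.
\<close>

definition compatible :: "bmat \<Rightarrow> bmat \<Rightarrow> bmat \<Rightarrow> bool" where
  "compatible M X Y = (if one_plus_invertible (badd X Y) then one_plus_invertible (badd M (badd X Y)) else False)"

fun all_recognised :: "bmat \<Rightarrow> ((bmat \<Rightarrow> bool) \<times> bmat list) list \<Rightarrow> bmat list \<Rightarrow> bool" where
  "all_recognised M cs [] = True"
| "all_recognised M cs (X # Xs) =
     (if list_all (recognised cs X) (filter (compatible M X) Xs)
      then all_recognised M cs Xs else False)"

lemma with_last_rowD: "P \<in> set (with_last_row M T r s ts) \<Longrightarrow> bdet P \<and> T (bconj P M)"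
proof (induction ts)
  case (Cons t ts)
  then show ?case by (simp only: with_last_row.simps set_simps split: if_split_asm) blast+
qed simp

lemma with_middle_rowD: "P \<in> set (with_middle_row M T r ss) \<Longrightarrow> bdet P \<and> T (bconj P M)"
proof (induction ss)
  case (Cons s ss)
  then show ?case
    by (simp only: with_middle_row.simps set_append Un_iff) (blast dest: with_last_rowD)
qed simp

lemma with_first_rowD: "P \<in> set (with_first_row M T rs) \<Longrightarrow> bdet P \<and> T (bconj P M)"
proof (induction rs)
  case (Cons r rs)
  then show ?case
    by (simp only: with_first_row.simps set_append Un_iff) (blast dest: with_middle_rowD)
qed simp

lemma some_conjugatesD:
  "some_conjugates T X Y Ps \<Longrightarrow> \<exists>P \<in> set Ps. T (bconj P X) \<and> T (bconj P Y)"
proof (induction Ps)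
  case (Cons P Ps)
  then show ?case by (simp only: some_conjugates.simps set_simps split: if_split_asm) blast+
qed simp

lemma recognisedD:
  "recognised cs X Y \<Longrightarrow> \<exists>(T, Ps) \<in> set cs. \<exists>P \<in> set Ps. T (bconj P X) \<and> T (bconj P Y)"
proof (induction cs)
  case (Cons c cs)
  obtain T Ps where c: "c = (T, Ps)" by (cases c)
  show ?case
  proof (cases "some_conjugates T X Y Ps")
    case True
    then show ?thesis unfolding c using some_conjugatesD by fastforce
  next
    case False
    then have "recognised cs X Y" using Cons.prems by (simp only: c recognised.simps if_False)
    then show ?thesis using Cons.IH by auto
  qed
qed simp

text \<open>
  The search treats each unordered pair once, in the order of the list, so that either order of
  \<open>X\<close> and \<open>Y\<close> may have been tested.
\<close>

lemma all_recognisedD: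
  assumes "all_recognised M cs Xs" "X \<in> set Xs" "Y \<in> set Xs" "X \<noteq> Y" "compatible M X Y"
  shows "recognised cs X Y \<or> recognised cs Y X"
  using assms
proof (induction M cs Xs rule: all_recognised.induct)
  case (2 M cs Z Zs)
  have rec: "list_all (recognised cs Z) (filter (compatible M Z) Zs)" "all_recognised M cs Zs"
    using "2.prems"(1) by (simp_all split: if_splits)
  have Z: "recognised cs Z N" if "N \<in> set Zs" "compatible M Z N" for N
    using rec(1) that unfolding list_all_iff set_filter by blast
  have "compatible M Y X" using "2.prems"(5) by (simp add: compatible_def badd_comm split: if_splits)
  then consider "X = Z" "Y \<in> set Zs" | "Y = Z" "X \<in> set Zs" "compatible M Z X"
    | "X \<in> set Zs" "Y \<in> set Zs"
    using "2.prems" by auto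
  then show ?case
  proof cases
    case 3
    then show ?thesis using "2.IH" "2.prems"(1,4,5) rec(1) by (simp split: if_splits)
  qed (use Z "2.prems"(5) in auto)
qed simp

text \<open>
  The lists of partners have 35, 27, 27, 23 and 23 elements, so each of the five computations
  inspects at most 595 pairs.
\<close>

lemma search_succeeds:
  "all_recognised unit12 (conjugators unit12) (partners unit12)"
  "all_recognised (companion (False, False, False)) (conjugators (companion (False, False, False)))
    (partners (companion (False, False, False)))"
  "all_recognised (companion (False, True, True)) (conjugators (companion (False, True, True)))
    (partners (companion (False, True, True)))"
  "all_recognised (companion (True, False, True)) (conjugators (companion (True, False, True)))
    (partners (companion (True, False, True)))"
  "all_recognised (companion (True, True, False)) (conjugators (companion (True, True, False)))
    (partners (companion (True, True, False)))"
  by code_simp+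

lemma search_succeeds_normal_form:
  assumes "normal_form M"
  shows "all_recognised M (conjugators M) (partners M)"
  using assms search_succeeds unfolding normal_form_def by blast

lemma pair_recognised:
  assumes M: "normal_form M"
    and X: "X \<noteq> bzero" "entry12_zero X" "one_plus_invertible X" "one_plus_invertible (badd M X)"
    and Y: "Y \<noteq> bzero" "entry12_zero Y" "one_plus_invertible Y" "one_plus_invertible (badd M Y)"
    and XY: "X \<noteq> Y" "one_plus_invertible (badd X Y)" "one_plus_invertible (badd M (badd X Y))"
  shows "\<exists>T \<in> set models. \<exists>P. bdet P \<and> T (bconj P M) \<and> T (bconj P X) \<and> T (bconj P Y)"
proof -
  have "X \<in> set (partners M)" "Y \<in> set (partners M)"
    using X Y by (simp_all add: partners_def set_tl_bmats)
  then have "recognised (conjugators M) X Y \<or> recognised (conjugators M) Y X"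
    using all_recognisedD[OF search_succeeds_normal_form[OF M]] XY by (simp add: compatible_def)
  then obtain T Ps P where "(T, Ps) \<in> set (conjugators M)" "P \<in> set Ps"
    and "T (bconj P X)" "T (bconj P Y)"
    by (auto dest!: recognisedD)
  moreover from this have "T \<in> set models" "P \<in> set (with_first_row M T bvecs)"
    by (auto simp: conjugators_def)
  ultimately show ?thesis using with_first_rowD by blast
qed

section \<open>Completeness of the list\<close>

lemma bconj_inj:
  assumes "bdet P"
  shows "inj (bconj P)"
proof (rule inj_on_inverseI)
  fix M
  have "bmult (bmult (badj P) (bconj P M)) P = bmult (bmult (badj P) P) (bmult M (bmult (badj P) P))"
    by (simp only: bconj.simps bmult_assoc)
  then show "bmult (bmult (badj P) (bconj P M)) P = M" by (simp add: badj_inverse[OF assms])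
qed

lemma entry12_zero_badd: "entry12_zero (badd M N) \<longleftrightarrow> (entry12_zero M \<longleftrightarrow> entry12_zero N)"
  by (cases M rule: entry12_zero.cases; cases N rule: entry12_zero.cases) auto

lemma normal_form_entry12: "normal_form M \<Longrightarrow> \<not> entry12_zero M"
  by (auto simp: normal_form_def unit12_def)

text \<open>
  The entry in row one and column two is a linear functional on \<open>S\<close> that takes the value one at
  \<open>M\<close>. Its kernel \<open>Z\<close> has four elements and is spanned by any two distinct nonzero ones, \<open>X\<close> and \<open>Y\<close>.
  A conjugation that carries \<open>M\<close>, \<open>X\<close> and \<open>Y\<close> into a model carries all of \<open>S\<close> into it, and onto it
  because both have eight elements.
\<close>

lemma recognise:
  assumes zero: "bzero \<in> S" and add: "\<And>X Y. X \<in> S \<Longrightarrow> Y \<in> S \<Longrightarrow> badd X Y \<in> S"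
    and card: "card S = 8" and ok: "\<And>X. X \<in> S \<Longrightarrow> one_plus_invertible X"
    and M: "M \<in> S" "normal_form M"
  shows "\<exists>T \<in> set models. \<exists>P. bdet P \<and> bconj P ` S = Collect T"
proof -
  define Z where "Z = {X \<in> S. entry12_zero X}"
  have fin: "finite S" by (rule card_ge_0_finite) (simp only: card)
  then have finZ: "finite Z" by (simp add: Z_def)
  have top: "entry12_zero (badd M X) \<longleftrightarrow> \<not> entry12_zero X" for X
    using normal_form_entry12[OF M(2)] by (simp add: entry12_zero_badd)
  have split: "S = Z \<union> badd M ` Z"
  proof (intro equalityI subsetI)
    fix X assume X: "X \<in> S"
    show "X \<in> Z \<union> badd M ` Z"
    proof (cases "entry12_zero X")
      case False
      then have "badd M X \<in> Z" using X M(1) add top by (simp add: Z_def)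
      then show ?thesis by (metis UnI2 badd_cancel imageI)
    qed (simp add: X Z_def)
  next
    fix X assume "X \<in> Z \<union> badd M ` Z"
    then show "X \<in> S" unfolding Z_def using M(1) add by blast
  qed
  have "Z \<inter> badd M ` Z = {}" unfolding Z_def using top by blast
  moreover have "card (badd M ` Z) = card Z"
    by (intro card_image inj_onI) (simp add: badd_left_cancel)
  ultimately have "card S = 2 * card Z"
    using split finZ by (simp add: card_Un_disjoint)
  then have cardZ: "card Z = 4" using card by simp
  have "Z - {bzero} \<noteq> {}"
  proof
    assume "Z - {bzero} = {}"
    then have "card Z \<le> card {bzero}" by (intro card_mono) auto
    then show False using cardZ by simp
  qed
  then obtain X where X: "X \<in> Z" "X \<noteq> bzero" by blast
  have "Z - {bzero, X} \<noteq> {}"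
  proof
    assume "Z - {bzero, X} = {}"
    then have "card Z \<le> card {bzero, X}" by (intro card_mono) auto
    then show False using cardZ X(2) by simp
  qed
  then obtain Y where "Y \<in> Z - {bzero, X}" by blast
  then have Y: "Y \<in> Z" "Y \<noteq> bzero" "X \<noteq> Y" by blast+
  have ZS: "N \<in> S" "entry12_zero N" if "N \<in> Z" for N using that by (auto simp: Z_def)
  have XYS: "badd X Y \<in> S" by (intro add ZS(1) X(1) Y(1))
  have "entry12_zero bzero" by (simp add: bzero_def)
  moreover have "entry12_zero (badd X Y)"
    using ZS(2)[OF X(1)] ZS(2)[OF Y(1)] by (simp only: entry12_zero_badd)
  ultimately have sub: "{bzero, X, Y, badd X Y} \<subseteq> Z"
    using X(1) Y(1) zero XYS unfolding Z_def by blast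
  have "badd X Y \<noteq> bzero" using Y(3) badd_left_cancel[of X Y X] by (simp add: badd_self)
  moreover have "badd X Y \<noteq> X" using Y(2) badd_left_cancel[of X Y bzero] by simp
  moreover have "badd X Y \<noteq> Y" using X(2) badd_left_cancel[of Y X bzero] by (simp add: badd_comm)
  ultimately have "distinct [bzero, X, Y, badd X Y]" using X(2) Y(2,3) by simp
  then have "card {bzero, X, Y, badd X Y} = card Z"
    using cardZ distinct_card[of "[bzero, X, Y, badd X Y]"] by (simp only: list.set list.size)
  then have Zeq: "Z = {bzero, X, Y, badd X Y}" by (rule card_subset_eq[OF finZ sub, symmetric])
  have "\<exists>T \<in> set models. \<exists>P. bdet P \<and> T (bconj P M) \<and> T (bconj P X) \<and> T (bconj P Y)"
    by (rule pair_recognised[OF M(2) X(2) ZS(2)[OF X(1)] ok ok Y(2) ZS(2)[OF Y(1)] ok ok Y(3) ok ok])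
      (rule ZS(1)[OF X(1)] ZS(1)[OF Y(1)] XYS add[OF M(1) ZS(1)[OF X(1)]]
        add[OF M(1) ZS(1)[OF Y(1)]] add[OF M(1) XYS])+
  then obtain T P where T: "T \<in> set models" and P: "bdet P"
    and TM: "T (bconj P M)" and TX: "T (bconj P X)" and TY: "T (bconj P Y)"
    by blast
  have TZ: "T (bconj P N)" if "N \<in> Z" for N
  proof -
    have "bconj P bzero = bzero" by (metis badd_self bconj_badd)
    then have "T (bconj P bzero)" by (simp only: model_zero[OF T])
    moreover have "T (bconj P (badd X Y))" unfolding bconj_badd by (rule model_add[OF T TX TY])
    ultimately show ?thesis using that TX TY unfolding Zeq by blast
  qed
  have "T (bconj P (badd M N))" if "N \<in> Z" for N
    unfolding bconj_badd by (rule model_add[OF T TM TZ[OF that]])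
  then have "bconj P ` S \<subseteq> Collect T" unfolding split using TZ by blast
  moreover have "card (bconj P ` S) = card S"
    by (rule card_image[OF inj_on_subset[OF bconj_inj[OF P] subset_UNIV]])
  then have "card (bconj P ` S) = card (Collect T)" by (simp only: card card_model[OF T])
  moreover have "finite (Collect T)" by (rule card_ge_0_finite) (simp only: card_model[OF T])
  ultimately have "bconj P ` S = Collect T" by (intro card_subset_eq)
  then show ?thesis using T P by blast
qed

lemma mat_of_GL: "bdet P \<Longrightarrow> mat_of P \<in> GL 3"
  by (simp add: mat_of_GL_iff)

lemma badj_GL: "bdet P \<Longrightarrow> mat_of (badj P) \<in> GL 3"
  using badj_inverse[of P] by (intro GL_I[of _ _ "mat_of P"]) (simp_all flip: mat_of_mult mat_of_one)

lemma equivalent_translate_conj: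
  assumes P: "bdet P" and W: "lin_subspace 3 W"
  shows "equivalent_sets 3 (translate (1\<^sub>m 3) W)
    (translate (1\<^sub>m 3) ((\<lambda>X. mat_of P * X * mat_of (badj P)) ` W))"
proof -
  have "mat_of P * 1\<^sub>m 3 * mat_of (badj P) = 1\<^sub>m 3"
    using badj_inverse[OF P] by (simp flip: mat_of_one mat_of_mult)
  then have "(\<lambda>X. mat_of P * X * mat_of (badj P)) ` translate (1\<^sub>m 3) W =
      translate (1\<^sub>m 3) ((\<lambda>X. mat_of P * X * mat_of (badj P)) ` W)"
    using sandwich_translate[of "mat_of P" 3 "mat_of (badj P)" "1\<^sub>m 3" W] W
    by (simp add: lin_subspace_iff)
  then show ?thesis
    using mat_of_GL[OF P] badj_GL[OF P] unfolding equivalent_sets_def by metis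
qed

lemma bconj_image: "(\<lambda>X. mat_of P * X * mat_of (badj P)) ` mat_of ` S = mat_of ` bconj P ` S"
  by (simp add: image_image mat_of_bconj)

lemma translate_mat_of: "translate (mat_of A) (mat_of ` S) = mat_of ` badd A ` S"
  by (simp add: translate_def image_image mat_of_add)

text \<open>
  Left multiplication by the transvection sends \<open>I + X\<close> to the transvection plus an element of
  \<open>T2\<close>, and the transvection differs from \<open>I\<close> by an element of \<open>T2\<close>.
\<close>

lemma shifted_T2_equivalent:
  "equivalent_sets 3 (translate (1\<^sub>m 3) (space_of in_T2_shifted)) (translate (1\<^sub>m 3) (space_of in_T2))"
proof -
  let ?E = "((False, False, False), (False, False, True), (False, False, False))"
  have inv: "bmult transvection transvection = bone" and E: "transvection = badd bone ?E"
    by (simp_all add: transvection_def bone_def)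
  have "bmult transvection ` badd bone ` Collect in_T2_shifted = badd bone ` Collect in_T2"
  proof (intro equalityI subsetI)
    fix Y assume "Y \<in> bmult transvection ` badd bone ` Collect in_T2_shifted"
    then obtain X where X: "in_T2 (bmult transvection X)" and "Y = bmult transvection (badd bone X)"
      by (auto simp: in_T2_shifted_def)
    then have "Y = badd bone (badd ?E (bmult transvection X))"
      by (simp only: bmult_badd bmult_bone) (simp only: E badd_assoc)
    moreover have "in_T2 (badd ?E (bmult transvection X))" by (intro in_T2_badd X) simp
    ultimately show "Y \<in> badd bone ` Collect in_T2" by blast
  next
    fix Y assume "Y \<in> badd bone ` Collect in_T2"
    then obtain N where N: "in_T2 N" and Y: "Y = badd bone N" by blast
    let ?X = "bmult transvection (badd ?E N)"
    have tX: "bmult transvection ?X = badd ?E N" by (simp only: bmult_assoc[symmetric] inv bmult_bone)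
    have "in_T2 (badd ?E N)" by (intro in_T2_badd N) simp
    then have "in_T2_shifted ?X" unfolding in_T2_shifted_def tX .
    moreover have "bmult transvection (badd bone ?X) = Y"
    proof -
      have "bmult transvection (badd bone ?X) = badd transvection (badd ?E N)"
        using bmult_badd[of transvection bone ?X] by (simp only: tX bmult_bone)
      also have "\<dots> = Y" by (simp only: E Y badd_assoc badd_cancel)
      finally show ?thesis .
    qed
    ultimately show "Y \<in> bmult transvection ` badd bone ` Collect in_T2_shifted" by blast
  qed
  moreover have "mat_of transvection * mat_of X * mat_of bone = mat_of (bmult transvection X)" for X
    by (simp flip: mat_of_mult)
  then have "(\<lambda>X. mat_of transvection * X * mat_of bone) ` mat_of ` B = mat_of ` bmult transvection ` B"
    for B by (simp only: image_image)
  ultimately have "mat_of ` badd bone ` Collect in_T2 =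
      (\<lambda>X. mat_of transvection * X * mat_of bone) ` mat_of ` badd bone ` Collect in_T2_shifted"
    by (simp only:)
  moreover have "bdet transvection" "bdet bone" by (simp_all add: transvection_def bone_def)
  ultimately show ?thesis
    unfolding equivalent_sets_def space_of_def mat_of_one[symmetric] translate_mat_of
    using mat_of_GL by blast
qed

text \<open>
  Two conjugations: the first brings one nonzero element into normal form, the second one is
  the result of the search.
\<close>

lemma classification:
  assumes W: "lin_subspace 3 W" and card: "card W = 8" and GL: "translate (1\<^sub>m 3) W \<subseteq> GL 3"
  shows "\<exists>T \<in> set models. equivalent_sets 3 (translate (1\<^sub>m 3) (space_of T)) (translate (1\<^sub>m 3) W)"
proof -
  define S where "S = {M. mat_of M \<in> W}"
  have Wc: "W \<subseteq> carrier_mat 3 3" using W by (simp add: lin_subspace_iff)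
  have WS: "W = mat_of ` S" using Wc by (auto simp: S_def elim!: mat_of_surj)
  have cardS: "card S = 8" using card unfolding WS by (simp add: card_image inj_on_def)
  have "S \<noteq> {bzero}" using cardS by auto
  moreover have "S \<noteq> {}" using cardS by auto
  ultimately obtain M where M: "M \<in> S" "M \<noteq> bzero" by blast
  have ok: "one_plus_invertible X" if "X \<in> S" for X
    using that GL by (auto simp: one_plus_invertible_iff S_def translate_def)
  obtain P where P: "bdet P" "normal_form (bconj P M)"
    using conjugate_to_normal_form ok M by blast
  define S' where "S' = bconj P ` S"
  let ?W' = "mat_of ` S'"
  have W'eq: "?W' = (\<lambda>X. mat_of P * X * mat_of (badj P)) ` W"
    unfolding S'_def WS bconj_image ..
  have W': "lin_subspace 3 ?W'"
    unfolding W'eq using sandwich_subspace(1) mat_of_GL badj_GL P(1) W by blast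
  have eq1: "equivalent_sets 3 (translate (1\<^sub>m 3) W) (translate (1\<^sub>m 3) ?W')"
    unfolding W'eq by (rule equivalent_translate_conj[OF P(1) W])
  have "translate (1\<^sub>m 3) ?W' \<subseteq> GL 3"
  proof -
    obtain R Q where "R \<in> GL 3" "Q \<in> GL 3"
      and "translate (1\<^sub>m 3) ?W' = (\<lambda>X. R * X * Q) ` translate (1\<^sub>m 3) W"
      using eq1 by (auto simp: equivalent_sets_def)
    then show ?thesis using GL by (auto intro!: GL_mult)
  qed
  then have ok': "one_plus_invertible X" if "X \<in> S'" for X
    using that by (auto simp: one_plus_invertible_iff translate_def)
  have "\<exists>T \<in> set models. \<exists>Q. bdet Q \<and> bconj Q ` S' = Collect T"
  proof (rule recognise)
    show "bzero \<in> S'" using W' by (simp add: lin_subspace_iff image_iff flip: mat_of_zero)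
    show "badd X Y \<in> S'" if "X \<in> S'" "Y \<in> S'" for X Y
    proof -
      have "mat_of X + mat_of Y \<in> ?W'" using W' that by (simp add: lin_subspace_iff)
      then show ?thesis by (auto simp flip: mat_of_add)
    qed
    show "card S' = 8" unfolding S'_def using bconj_inj[OF P(1)] cardS
      by (simp add: card_image inj_on_subset)
    show "bconj P M \<in> S'" using M(1) by (auto simp: S'_def)
  qed (use ok' P(2) in auto)
  then obtain T Q where T: "T \<in> set models" and Q: "bdet Q" "bconj Q ` S' = Collect T"
    by blast
  have "space_of T = (\<lambda>X. mat_of Q * X * mat_of (badj Q)) ` ?W'"
    unfolding space_of_def Q(2)[symmetric] bconj_image ..
  then have "equivalent_sets 3 (translate (1\<^sub>m 3) ?W') (translate (1\<^sub>m 3) (space_of T))"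
    using equivalent_translate_conj[OF Q(1) W'] by simp
  then have "equivalent_sets 3 (translate (1\<^sub>m 3) W) (translate (1\<^sub>m 3) (space_of T))"
    using eq1 equivalent_sets_trans translate_carrier[OF one_carrier_mat Wc] by blast
  then show ?thesis
    using T equivalent_sets_sym translate_carrier[OF one_carrier_mat Wc] by blast
qed

theorem theorem5p7:
  shows "(\<forall>H \<in> set translation_spaces.
             lin_subspace 3 H \<and> affine_subspace 3 3 (translate (1\<^sub>m 3) H) \<and>
             translate (1\<^sub>m 3) H \<subseteq> GL 3)
       \<and> (\<forall>i<5. \<forall>j<5. i \<noteq> j \<longrightarrow>
             \<not> equivalent_sets 3 (translate (1\<^sub>m 3) (translation_spaces ! i))
                                (translate (1\<^sub>m 3) (translation_spaces ! j)))
       \<and> (\<forall>\<A> :: bit mat set. affine_subspace 3 3 \<A> \<and> \<A> \<subseteq> GL 3 \<longrightarrow>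
             (\<exists>H \<in> set translation_spaces. equivalent_sets 3 (translate (1\<^sub>m 3) H) \<A>))"
proof (intro conjI ballI allI impI)
  fix H assume "H \<in> set translation_spaces"
  then obtain T where T: "T \<in> set representatives" and H: "H = space_of T"
    by (auto simp: translation_spaces_eq)
  from T have "T \<in> set models" by (simp add: models_def)
  then have sub: "lin_subspace 3 H" "lin_dim 3 H = 3" unfolding H by (rule model_lin_subspace)+
  show "lin_subspace 3 H" by (rule sub(1))
  show "affine_subspace 3 3 (translate (1\<^sub>m 3) H)"
    unfolding affine_subspace_def
    by (intro bexI[of _ "1\<^sub>m 3"] exI[of _ H] conjI sub refl one_carrier_mat)
  show "translate (1\<^sub>m 3) H \<subseteq> GL 3"
    unfolding H translate_def space_of_def using model_one_plus_invertible[OF T] one_plus_invertible_iff by blast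
next
  fix i j :: nat assume "i < 5" "j < 5" "i \<noteq> j"
  then show "\<not> equivalent_sets 3 (translate (1\<^sub>m 3) (translation_spaces ! i))
                                (translate (1\<^sub>m 3) (translation_spaces ! j))"
    by (rule inequivalent_translation_spaces)
next
  fix \<A> :: "bit mat set" assume A: "affine_subspace 3 3 \<A> \<and> \<A> \<subseteq> GL 3"
  then obtain A W where W: "lin_subspace 3 W" "lin_dim 3 W = 3" "A \<in> carrier_mat 3 3"
    and AW: "\<A> = translate A W"
    unfolding affine_subspace_def by blast
  obtain W' where W': "lin_subspace 3 W'" "card W' = card W" "translate (1\<^sub>m 3) W' \<subseteq> GL 3"
    and eq: "equivalent_sets 3 (translate (1\<^sub>m 3) W') \<A>"
    using equivalent_to_translate_of_one[OF W(1) _ W(3)] A unfolding AW by metis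
  have "card W' = 8" using card_bit_subspace[OF W(1)] W(2) W'(2) by simp
  then obtain T where T: "T \<in> set models"
    and eqT: "equivalent_sets 3 (translate (1\<^sub>m 3) (space_of T)) (translate (1\<^sub>m 3) W')"
    using classification[OF W'(1) _ W'(3)] by blast
  have carrier: "translate (1\<^sub>m 3) (space_of T') \<subseteq> carrier_mat 3 3" for T'
    by (rule translate_carrier) (auto simp: space_of_def)
  have eqTA: "equivalent_sets 3 (translate (1\<^sub>m 3) (space_of T)) \<A>"
    using equivalent_sets_trans[OF eqT eq carrier] .
  show "\<exists>H \<in> set translation_spaces. equivalent_sets 3 (translate (1\<^sub>m 3) H) \<A>"
  proof (cases "T \<in> set representatives")
    case True
    then have "space_of T \<in> set translation_spaces" unfolding translation_spaces_eq by simp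
    then show ?thesis using eqTA by blast
  next
    case False
    then have "T = in_T2_shifted" using T by (simp add: models_def)
    then have shifted: "equivalent_sets 3 (translate (1\<^sub>m 3) (space_of in_T2_shifted)) \<A>"
      using eqTA by (simp only:)
    have "equivalent_sets 3 (translate (1\<^sub>m 3) (space_of in_T2)) \<A>"
      by (rule equivalent_sets_trans[OF equivalent_sets_sym[OF shifted_T2_equivalent carrier]
            shifted carrier])
    moreover have "space_of in_T2 \<in> set translation_spaces"
      unfolding translation_spaces_eq representatives_def by simp
    ultimately show ?thesis by blast
  qed
qed

end
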